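(* Let $k$ be a field, $V$ a $k$-vector space and $A=T(V)/(R)$ a quadratic algebra with $R\subseteq V\otimes V$. For any Koszul cochain $f$ with coefficients in any $A$-bimodule $M$ (that is, any $k$-linear map $f:W_p\to M$, $p\ge 0$), the following formula holds: $$[e_A,f]_{\smile_K}=-b_K(f).$$
   Context: $W_0=k$, $W_1=V$, $W_p=\bigcap_{i+2+j=p}V^{\otimes i}\otimes R\otimes V^{\otimes j}\subseteq V^{\otimes p}$ for $p\ge2$. Elements of $W_p$ are written $x_1\ldots x_p$ (a sum of such tensors, $x_i\in V$), with the same notation when $W_p$ is viewed inside $V^{\otimes q}\otimes W_r\otimes V^{\otimes s}$, $q+r+s=p$. A Koszul $p$-cochain with coefficients in an $A$-bimodule $M$ is a $k$-linear map $f:W_p\to M$. Koszul differential: $b_K(f)(x_1\ldots x_{p+1})=f(x_1\ldots x_p).x_{p+1}-(-1)^px_1.f(x_2\ldots x_{p+1})$. Koszul cup product of $f:W_p\to P$ and $g:W_q\to Q$ ($P,Q$ bimodules): $f\smile_K g:W_{p+q}\to P\otimes_AQ$, $(f\smile_K g)(x_1\ldots x_{p+q})=(-1)^{pq}f(x_1\ldots x_p)\otimes_A g(x_{p+1}\ldots x_{p+q})$. If $P$ or $Q$ equals $A$ (identifying $A\otimes_AM\cong M\cong M\otimes_AA$), the Koszul cup bracket is $[f,g]_{\smile_K}=f\smile_Kg-(-1)^{pq}g\smile_Kf$. $e_A:V\to A$ is the fundamental $1$-cocycle, $e_A(x)=x$ for $x\in V$. *)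

theory Defs
  imports
    "HOL-Algebra.QuotRing"
    "HOL-Algebra.Module"
    "HOL-Algebra.Free_Abelian_Groups"
    "HOL-Algebra.Algebraic_Closure_Type"
begin

section \<open>The tensor algebra of a vector space\<close>

text \<open>
  Words form the free monoid under concatenation, so that the type of finitely supported
  functions from words over the underlying set of \<open>V\<close> to \<open>k\<close>, with the convolution product of
  \<^theory>\<open>HOL-Library.Poly_Mapping\<close>, is the free associative unital \<open>k\<close>-algebra on the
  underlying set of \<open>V\<close>.
\<close>

instantiation list :: (type) monoid_add
begin

definition zero_list :: "'a list" where "zero_list = []"

definition plus_list :: "'a list \<Rightarrow> 'a list \<Rightarrow> 'a list" where "plus_list = append"

instance by standard (simp_all add: zero_list_def plus_list_def)

end

text \<open>
  The vector space \<open>V\<close> is the type \<open>'v\<close> with the scalar multiplication \<open>scale\<close>. Its tensor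
  algebra \<open>T(V)\<close> is the free algebra modulo the relations \<open>[x + y] = [x] + [y]\<close> and
  \<open>[c x] = c [x]\<close> on letters; elements of \<open>T(V)\<close> are cosets.
\<close>

definition linearity_ideal ::
    "('k::field \<Rightarrow> 'v::ab_group_add \<Rightarrow> 'v) \<Rightarrow> ('v list \<Rightarrow>\<^sub>0 'k) set" where
  "linearity_ideal scale = Idl\<^bsub>ring_of_type_algebra\<^esub>
     ({Poly_Mapping.single [x + y] 1 - Poly_Mapping.single [x] 1 - Poly_Mapping.single [y] 1
         | x y. True} \<union>
      {Poly_Mapping.single [scale c x] 1 - Poly_Mapping.single [x] c | c x. True})"

definition tensor_coset ::
    "('k::field \<Rightarrow> 'v::ab_group_add \<Rightarrow> 'v) \<Rightarrow> ('v list \<Rightarrow>\<^sub>0 'k) \<Rightarrow> ('v list \<Rightarrow>\<^sub>0 'k) set" where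
  "tensor_coset scale u = linearity_ideal scale +>\<^bsub>ring_of_type_algebra\<^esub> u"

definition tensor_algebra ::
    "('k::field \<Rightarrow> 'v::ab_group_add \<Rightarrow> 'v) \<Rightarrow> ('k, ('v list \<Rightarrow>\<^sub>0 'k) set) module" where
  "tensor_algebra scale =
     (let Q = ring_of_type_algebra Quot linearity_ideal scale
      in \<lparr>carrier = carrier Q, monoid.mult = (\<lambda>x y. x \<otimes>\<^bsub>Q\<^esub> y), one = \<one>\<^bsub>Q\<^esub>,
          ring.zero = \<zero>\<^bsub>Q\<^esub>, add = (\<lambda>x y. x \<oplus>\<^bsub>Q\<^esub> y),
          module.smult = (\<lambda>c x. tensor_coset scale (Poly_Mapping.single [] c) \<otimes>\<^bsub>Q\<^esub> x)\<rparr>)"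

text \<open>\<open>V\<^sup>\<otimes>\<^sup>p\<close> is the component of degree \<open>p\<close> of \<open>T(V)\<close>; in particular \<open>V\<^sup>\<otimes>\<^sup>0 = k\<close>
  and \<open>V\<^sup>\<otimes>\<^sup>1 = V\<close>.\<close>

definition tensor_power ::
    "('k::field \<Rightarrow> 'v::ab_group_add \<Rightarrow> 'v) \<Rightarrow> nat \<Rightarrow> ('v list \<Rightarrow>\<^sub>0 'k) set set" where
  "tensor_power scale p =
     tensor_coset scale ` {u. \<forall>w\<in>Poly_Mapping.keys u. length w = p}"

text \<open>
  For subspaces \<open>S \<subseteq> V\<^sup>\<otimes>\<^sup>p\<close> and \<open>S' \<subseteq> V\<^sup>\<otimes>\<^sup>q\<close>, the tensor product \<open>S \<otimes> S'\<close> is identified with the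
  subspace of \<open>V\<^sup>\<otimes>\<^sup>(\<^sup>p\<^sup>+\<^sup>q\<^sup>)\<close> consisting of the finite sums of products \<open>x y\<close> in \<open>T(V)\<close>.
\<close>

definition tensor_span :: "('t, 'z) ring_scheme \<Rightarrow> 't set \<Rightarrow> 't set \<Rightarrow> 't set" where
  "tensor_span T S S' =
     {finsum T (\<lambda>i. a i \<otimes>\<^bsub>T\<^esub> b i) {..<m} | (m::nat) a b. \<forall>i<m. a i \<in> S \<and> b i \<in> S'}"

text \<open>
  The homomorphism \<open>S \<otimes> S' \<rightarrow> N\<close>, \<open>x y \<mapsto> B x y\<close>, induced by a \<open>k\<close>-balanced biadditive map \<open>B\<close>
  into an abelian group \<open>N\<close>, which is written multiplicatively as in
  \<^theory>\<open>HOL-Algebra.Free_Abelian_Groups\<close>. This is what the notation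
  \<open>x\<^sub>1 \<dots> x\<^sub>p\<^sub>+\<^sub>q \<mapsto> B (x\<^sub>1 \<dots> x\<^sub>p) (x\<^sub>p\<^sub>+\<^sub>1 \<dots> x\<^sub>p\<^sub>+\<^sub>q)\<close> means: the argument, a sum of pure tensors, is
  viewed inside \<open>S \<otimes> S'\<close>.
\<close>

definition tensor_lift ::
    "('t, 'z) ring_scheme \<Rightarrow> 't set \<Rightarrow> 't set \<Rightarrow> ('n, 'y) monoid_scheme \<Rightarrow>
     ('t \<Rightarrow> 't \<Rightarrow> 'n) \<Rightarrow> 't \<Rightarrow> 'n" where
  "tensor_lift T S S' N B w =
     (THE n. \<exists>(m::nat) a b. (\<forall>i<m. a i \<in> S \<and> b i \<in> S') \<and>
        w = finsum T (\<lambda>i. a i \<otimes>\<^bsub>T\<^esub> b i) {..<m} \<and>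
        n = finprod N (\<lambda>i. B (a i) (b i)) {..<m})"


section \<open>Bimodules and tensor products over a ring\<close>

record ('a, 'm) bimodule = "'m ring" +
  lact :: "'a \<Rightarrow> 'm \<Rightarrow> 'm"
  ract :: "'m \<Rightarrow> 'a \<Rightarrow> 'm"

locale bimodule = A?: ring A + M?: abelian_group M
  for A :: "('a, 'z) ring_scheme" (structure) and M :: "('a, 'm) bimodule" (structure) +
  assumes lact_closed: "\<lbrakk>a \<in> carrier A; x \<in> carrier M\<rbrakk> \<Longrightarrow> lact M a x \<in> carrier M"
    and ract_closed: "\<lbrakk>x \<in> carrier M; a \<in> carrier A\<rbrakk> \<Longrightarrow> ract M x a \<in> carrier M"
    and lact_l_distr: "\<lbrakk>a \<in> carrier A; b \<in> carrier A; x \<in> carrier M\<rbrakk> \<Longrightarrow>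
      lact M (a \<oplus>\<^bsub>A\<^esub> b) x = lact M a x \<oplus>\<^bsub>M\<^esub> lact M b x"
    and lact_r_distr: "\<lbrakk>a \<in> carrier A; x \<in> carrier M; y \<in> carrier M\<rbrakk> \<Longrightarrow>
      lact M a (x \<oplus>\<^bsub>M\<^esub> y) = lact M a x \<oplus>\<^bsub>M\<^esub> lact M a y"
    and ract_l_distr: "\<lbrakk>x \<in> carrier M; y \<in> carrier M; a \<in> carrier A\<rbrakk> \<Longrightarrow>
      ract M (x \<oplus>\<^bsub>M\<^esub> y) a = ract M x a \<oplus>\<^bsub>M\<^esub> ract M y a"
    and ract_r_distr: "\<lbrakk>x \<in> carrier M; a \<in> carrier A; b \<in> carrier A\<rbrakk> \<Longrightarrow>
      ract M x (a \<oplus>\<^bsub>A\<^esub> b) = ract M x a \<oplus>\<^bsub>M\<^esub> ract M x b"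
    and lact_assoc: "\<lbrakk>a \<in> carrier A; b \<in> carrier A; x \<in> carrier M\<rbrakk> \<Longrightarrow>
      lact M (a \<otimes>\<^bsub>A\<^esub> b) x = lact M a (lact M b x)"
    and ract_assoc: "\<lbrakk>x \<in> carrier M; a \<in> carrier A; b \<in> carrier A\<rbrakk> \<Longrightarrow>
      ract M x (a \<otimes>\<^bsub>A\<^esub> b) = ract M (ract M x a) b"
    and lact_ract: "\<lbrakk>a \<in> carrier A; x \<in> carrier M; b \<in> carrier A\<rbrakk> \<Longrightarrow>
      ract M (lact M a x) b = lact M a (ract M x b)"
    and lact_one: "x \<in> carrier M \<Longrightarrow> lact M \<one>\<^bsub>A\<^esub> x = x"
    and ract_one: "x \<in> carrier M \<Longrightarrow> ract M x \<one>\<^bsub>A\<^esub> = x"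

definition regular_bimodule :: "('a, 'z) ring_scheme \<Rightarrow> ('a, 'a) bimodule" where
  "regular_bimodule A =
     \<lparr>carrier = carrier A, monoid.mult = (\<lambda>x y. x \<otimes>\<^bsub>A\<^esub> y), one = \<one>\<^bsub>A\<^esub>,
      ring.zero = \<zero>\<^bsub>A\<^esub>, add = (\<lambda>x y. x \<oplus>\<^bsub>A\<^esub> y),
      lact = (\<lambda>a x. a \<otimes>\<^bsub>A\<^esub> x), ract = (\<lambda>x a. x \<otimes>\<^bsub>A\<^esub> a)\<rparr>"

text \<open>The tensor product \<open>P \<otimes>\<^sub>A Q\<close> as an abelian group, written multiplicatively.\<close>

definition balancing_subgroup ::
    "('a, 'z) ring_scheme \<Rightarrow> ('a, 'p) bimodule \<Rightarrow> ('a, 'q) bimodule \<Rightarrow> ('p \<times> 'q \<Rightarrow>\<^sub>0 int) set" where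
  "balancing_subgroup A P Q = generate (free_Abelian_group (carrier P \<times> carrier Q))
     ({frag_of (x \<oplus>\<^bsub>P\<^esub> x', y) - frag_of (x, y) - frag_of (x', y)
         | x x' y. x \<in> carrier P \<and> x' \<in> carrier P \<and> y \<in> carrier Q} \<union>
      {frag_of (x, y \<oplus>\<^bsub>Q\<^esub> y') - frag_of (x, y) - frag_of (x, y')
         | x y y'. x \<in> carrier P \<and> y \<in> carrier Q \<and> y' \<in> carrier Q} \<union>
      {frag_of (ract P x a, y) - frag_of (x, lact Q a y)
         | x a y. x \<in> carrier P \<and> a \<in> carrier A \<and> y \<in> carrier Q})"

definition tensor_over ::
    "('a, 'z) ring_scheme \<Rightarrow> ('a, 'p) bimodule \<Rightarrow> ('a, 'q) bimodule \<Rightarrow>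
     ('p \<times> 'q \<Rightarrow>\<^sub>0 int) set monoid" where
  "tensor_over A P Q = free_Abelian_group (carrier P \<times> carrier Q) Mod balancing_subgroup A P Q"

definition pure_tensor ::
    "('a, 'z) ring_scheme \<Rightarrow> ('a, 'p) bimodule \<Rightarrow> ('a, 'q) bimodule \<Rightarrow>
     'p \<Rightarrow> 'q \<Rightarrow> ('p \<times> 'q \<Rightarrow>\<^sub>0 int) set" where
  "pure_tensor A P Q x y =
     balancing_subgroup A P Q #>\<^bsub>free_Abelian_group (carrier P \<times> carrier Q)\<^esub> frag_of (x, y)"

text \<open>
  The identifications \<open>A \<otimes>\<^sub>A M \<cong> M\<close> and \<open>M \<otimes>\<^sub>A A \<cong> M\<close>, as the inverses of the bijections
  \<open>x \<mapsto> 1 \<otimes> x\<close> and \<open>x \<mapsto> x \<otimes> 1\<close>.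
\<close>

definition left_unitor ::
    "('a, 'z) ring_scheme \<Rightarrow> ('a, 'm) bimodule \<Rightarrow> ('a \<times> 'm \<Rightarrow>\<^sub>0 int) set \<Rightarrow> 'm" where
  "left_unitor A M =
     inv_into (carrier M) (\<lambda>x. pure_tensor A (regular_bimodule A) M \<one>\<^bsub>A\<^esub> x)"

definition right_unitor ::
    "('a, 'z) ring_scheme \<Rightarrow> ('a, 'm) bimodule \<Rightarrow> ('m \<times> 'a \<Rightarrow>\<^sub>0 int) set \<Rightarrow> 'm" where
  "right_unitor A M =
     inv_into (carrier M) (\<lambda>x. pure_tensor A M (regular_bimodule A) x \<one>\<^bsub>A\<^esub>)"


section \<open>Quadratic algebras\<close>

definition quadratic_relations ::
    "('k::field \<Rightarrow> 'v::ab_group_add \<Rightarrow> 'v) \<Rightarrow> ('v list \<Rightarrow>\<^sub>0 'k) set set \<Rightarrow> bool" where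
  "quadratic_relations scale R \<longleftrightarrow>
     submodule R (ring_of_type_algebra :: 'k ring) (tensor_algebra scale) \<and>
     R \<subseteq> tensor_power scale 2"

definition quadratic_projection ::
    "('k::field \<Rightarrow> 'v::ab_group_add \<Rightarrow> 'v) \<Rightarrow> ('v list \<Rightarrow>\<^sub>0 'k) set set \<Rightarrow>
     ('v list \<Rightarrow>\<^sub>0 'k) set \<Rightarrow> ('v list \<Rightarrow>\<^sub>0 'k) set set" where
  "quadratic_projection scale R x =
     (Idl\<^bsub>tensor_algebra scale\<^esub> R) +>\<^bsub>tensor_algebra scale\<^esub> x"

definition quadratic_algebra ::
    "('k::field \<Rightarrow> 'v::ab_group_add \<Rightarrow> 'v) \<Rightarrow> ('v list \<Rightarrow>\<^sub>0 'k) set set \<Rightarrow>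
     ('v list \<Rightarrow>\<^sub>0 'k) set set ring" where
  "quadratic_algebra scale R = tensor_algebra scale Quot (Idl\<^bsub>tensor_algebra scale\<^esub> R)"

definition quadratic_scalar ::
    "('k::field \<Rightarrow> 'v::ab_group_add \<Rightarrow> 'v) \<Rightarrow> ('v list \<Rightarrow>\<^sub>0 'k) set set \<Rightarrow>
     'k \<Rightarrow> ('v list \<Rightarrow>\<^sub>0 'k) set set" where
  "quadratic_scalar scale R c =
     quadratic_projection scale R (c \<odot>\<^bsub>tensor_algebra scale\<^esub> \<one>\<^bsub>tensor_algebra scale\<^esub>)"

text \<open>
  Bimodules over the \<open>k\<close>-algebra \<open>A\<close> are \<open>k\<close>-symmetric: the left and right actions of \<open>k\<close> agree, and
  they provide the structure of \<open>k\<close>-vector space.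
\<close>

definition quadratic_bimodule ::
    "('k::field \<Rightarrow> 'v::ab_group_add \<Rightarrow> 'v) \<Rightarrow> ('v list \<Rightarrow>\<^sub>0 'k) set set \<Rightarrow>
     (('v list \<Rightarrow>\<^sub>0 'k) set set, 'm) bimodule \<Rightarrow> bool" where
  "quadratic_bimodule scale R M \<longleftrightarrow>
     bimodule (quadratic_algebra scale R) M \<and>
     (\<forall>c. \<forall>x\<in>carrier M.
        lact M (quadratic_scalar scale R c) x = ract M x (quadratic_scalar scale R c))"


section \<open>Koszul calculus\<close>

definition koszul_space ::
    "('k::field \<Rightarrow> 'v::ab_group_add \<Rightarrow> 'v) \<Rightarrow> ('v list \<Rightarrow>\<^sub>0 'k) set set \<Rightarrow> nat \<Rightarrow>
     ('v list \<Rightarrow>\<^sub>0 'k) set set" where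
  "koszul_space scale R p =
     (if p < 2 then tensor_power scale p
      else \<Inter>(i, j)\<in>{(i, j). i + 2 + j = p}.
        tensor_span (tensor_algebra scale)
          (tensor_span (tensor_algebra scale) (tensor_power scale i) R) (tensor_power scale j))"

definition koszul_cochain ::
    "('k::field \<Rightarrow> 'v::ab_group_add \<Rightarrow> 'v) \<Rightarrow> ('v list \<Rightarrow>\<^sub>0 'k) set set \<Rightarrow> nat \<Rightarrow>
     (('v list \<Rightarrow>\<^sub>0 'k) set set, 'm) bimodule \<Rightarrow> (('v list \<Rightarrow>\<^sub>0 'k) set \<Rightarrow> 'm) \<Rightarrow> bool" where
  "koszul_cochain scale R p M f \<longleftrightarrow>
     (\<forall>w\<in>koszul_space scale R p. f w \<in> carrier M) \<and>
     (\<forall>w\<in>koszul_space scale R p. \<forall>w'\<in>koszul_space scale R p.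
        f (w \<oplus>\<^bsub>tensor_algebra scale\<^esub> w') = f w \<oplus>\<^bsub>M\<^esub> f w') \<and>
     (\<forall>c. \<forall>w\<in>koszul_space scale R p.
        f (c \<odot>\<^bsub>tensor_algebra scale\<^esub> w) = lact M (quadratic_scalar scale R c) (f w))"

definition koszul_differential ::
    "('k::field \<Rightarrow> 'v::ab_group_add \<Rightarrow> 'v) \<Rightarrow> ('v list \<Rightarrow>\<^sub>0 'k) set set \<Rightarrow> nat \<Rightarrow>
     (('v list \<Rightarrow>\<^sub>0 'k) set set, 'm) bimodule \<Rightarrow> (('v list \<Rightarrow>\<^sub>0 'k) set \<Rightarrow> 'm) \<Rightarrow>
     ('v list \<Rightarrow>\<^sub>0 'k) set \<Rightarrow> 'm" where
  "koszul_differential scale R p M f w =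
     tensor_lift (tensor_algebra scale) (koszul_space scale R p) (tensor_power scale 1)
       (add_monoid M) (\<lambda>u x. ract M (f u) (quadratic_projection scale R x)) w
     \<ominus>\<^bsub>M\<^esub> add_pow M ((- 1 :: int) ^ p)
       (tensor_lift (tensor_algebra scale) (tensor_power scale 1) (koszul_space scale R p)
         (add_monoid M) (\<lambda>x u. lact M (quadratic_projection scale R x) (f u)) w)"

text \<open>The power is the multiple by \<open>(- 1)\<^sup>p\<^sup>q\<close> in the multiplicatively written group.\<close>

definition koszul_cup ::
    "('k::field \<Rightarrow> 'v::ab_group_add \<Rightarrow> 'v) \<Rightarrow> ('v list \<Rightarrow>\<^sub>0 'k) set set \<Rightarrow> nat \<Rightarrow> nat \<Rightarrow>
     (('v list \<Rightarrow>\<^sub>0 'k) set set, 'm) bimodule \<Rightarrow> (('v list \<Rightarrow>\<^sub>0 'k) set set, 'n) bimodule \<Rightarrow>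
     (('v list \<Rightarrow>\<^sub>0 'k) set \<Rightarrow> 'm) \<Rightarrow> (('v list \<Rightarrow>\<^sub>0 'k) set \<Rightarrow> 'n) \<Rightarrow>
     ('v list \<Rightarrow>\<^sub>0 'k) set \<Rightarrow> ('m \<times> 'n \<Rightarrow>\<^sub>0 int) set" where
  "koszul_cup scale R p q P Q f g w =
     tensor_lift (tensor_algebra scale) (koszul_space scale R p) (koszul_space scale R q)
       (tensor_over (quadratic_algebra scale R) P Q)
       (\<lambda>u v. pure_tensor (quadratic_algebra scale R) P Q (f u) (g v)) w
     [^]\<^bsub>tensor_over (quadratic_algebra scale R) P Q\<^esub> ((- 1 :: int) ^ (p * q))"

text \<open>The bracket \<open>[f, g]\<close> of \<open>f : W\<^sub>p \<rightarrow> A\<close> and \<open>g : W\<^sub>q \<rightarrow> M\<close>, with values in \<open>M\<close>.\<close>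

definition koszul_cup_bracket ::
    "('k::field \<Rightarrow> 'v::ab_group_add \<Rightarrow> 'v) \<Rightarrow> ('v list \<Rightarrow>\<^sub>0 'k) set set \<Rightarrow> nat \<Rightarrow> nat \<Rightarrow>
     (('v list \<Rightarrow>\<^sub>0 'k) set set, 'm) bimodule \<Rightarrow>
     (('v list \<Rightarrow>\<^sub>0 'k) set \<Rightarrow> ('v list \<Rightarrow>\<^sub>0 'k) set set) \<Rightarrow> (('v list \<Rightarrow>\<^sub>0 'k) set \<Rightarrow> 'm) \<Rightarrow>
     ('v list \<Rightarrow>\<^sub>0 'k) set \<Rightarrow> 'm" where
  "koszul_cup_bracket scale R p q M f g w =
     (let A = quadratic_algebra scale R in
      left_unitor A M (koszul_cup scale R p q (regular_bimodule A) M f g w)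
      \<ominus>\<^bsub>M\<^esub> add_pow M ((- 1 :: int) ^ (p * q))
        (right_unitor A M (koszul_cup scale R q p M (regular_bimodule A) g f w)))"

definition fundamental_cocycle ::
    "('k::field \<Rightarrow> 'v::ab_group_add \<Rightarrow> 'v) \<Rightarrow> ('v list \<Rightarrow>\<^sub>0 'k) set set \<Rightarrow>
     ('v list \<Rightarrow>\<^sub>0 'k) set \<Rightarrow> ('v list \<Rightarrow>\<^sub>0 'k) set set" where
  "fundamental_cocycle scale R x = quadratic_projection scale R x"

end

theory Submission
  imports Defs
begin

text \<open>
  Pointwise, both sides are signed combinations of the two sums obtained from \<open>f(u).x\<close> and
  \<open>x.f(u)\<close> when \<open>w \<in> W\<^sub>p\<^sub>+\<^sub>1\<close> is written as \<open>\<Sum> u x\<close> in \<open>W\<^sub>p V\<close> and as \<open>\<Sum> x u\<close> in \<open>V W\<^sub>p\<close>, because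
  \<open>e\<^sub>A(x) \<otimes> f(u) = 1 \<otimes> x.f(u)\<close> and \<open>f(u) \<otimes> e\<^sub>A(x) = f(u).x \<otimes> 1\<close>. The content lies in the existence of
  these decompositions and in the independence of the sums from their choice.

  A basis \<open>B\<close> of \<open>V\<close> gives every element of \<open>T(V)\<close> a unique normal form in the free algebra,
  supported on words in \<open>B\<close>. Contracting \<open>w\<close> with the coordinate of its last (first) letter at
  \<open>b \<in> B\<close> maps \<open>W\<^sub>p\<^sub>+\<^sub>1\<close> to \<open>W\<^sub>p\<close>, since it only touches a factor \<open>V\<close> of
  \<open>V\<^sup>\<otimes>\<^sup>i \<otimes> R \<otimes> V\<^sup>\<otimes>\<^sup>j\<close> for suitable \<open>i\<close>, \<open>j\<close>, and \<open>w\<close> is the sum of its contractions times \<open>b\<close>.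
\<close>

section \<open>Free algebras\<close>

text \<open>Statements stable under addition need checking only on monomials. Updating at a key
  outside the support amounts to adding a monomial, which turns \<open>update_induct\<close> into
  this rule.\<close>

lemma poly_mapping_sum_induct [case_names zero single add]:
  fixes u :: "'a \<Rightarrow>\<^sub>0 'b::monoid_add"
  assumes "P 0"
    and "\<And>k c. P (Poly_Mapping.single k c)"
    and "\<And>u v. P u \<Longrightarrow> P v \<Longrightarrow> P (u + v)"
  shows "P u"
proof (induction u rule: Poly_Mapping.update_induct)
  case const
  then show ?case using assms(1) by simp
next
  case (update f a b)
  have "Poly_Mapping.update a b f = Poly_Mapping.single a b + f"
    by (rule poly_mapping_eqI)
      (use update(1) in \<open>auto simp: lookup_update lookup_add lookup_single when_def in_keys_iff\<close>)
  then show ?case using assms(2,3) update by metis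
qed

section \<open>Rings and ideals carried by a whole type\<close>

lemma ring_ring_of_type_algebra: "ring (ring_of_type_algebra :: 'a::ring_1 ring)"
proof -
  have "\<exists>y. x + y = 0 \<and> y + x = 0" for x :: 'a
    by (rule exI[of _ "- x"]) auto
  then show ?thesis
    unfolding ring_of_type_algebra_def
    by unfold_locales (auto simp: algebra_simps Units_def)
qed

lemma ring_of_type_algebra_simps:
  "carrier ring_of_type_algebra = UNIV"
  "x \<otimes>\<^bsub>ring_of_type_algebra\<^esub> y = x * y"
  "\<one>\<^bsub>ring_of_type_algebra\<^esub> = 1"
  "\<zero>\<^bsub>ring_of_type_algebra\<^esub> = 0"
  "x \<oplus>\<^bsub>ring_of_type_algebra\<^esub> y = x + y"
  by (simp_all add: ring_of_type_algebra_def)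

lemma a_inv_ring_of_type_algebra:
  fixes x :: "'a::ring_1"
  shows "\<ominus>\<^bsub>ring_of_type_algebra\<^esub> x = - x"
proof -
  interpret ring "ring_of_type_algebra :: 'a ring" by (rule ring_ring_of_type_algebra)
  show ?thesis by (rule minus_equality) (simp_all add: ring_of_type_algebra_simps)
qed

text \<open>Closure under negation comes from multiplication by \<open>- 1\<close>. The forward
  direction yields the closure rules of \<open>linearity_ideal\<close>; the backward one makes the
  zero set of \<open>nf\<close> an ideal.\<close>

lemma ideal_ring_of_type_algebra_iff:
  fixes I :: "'a::ring_1 set"
  shows "ideal I ring_of_type_algebra \<longleftrightarrow>
    0 \<in> I \<and> (\<forall>x\<in>I. \<forall>y\<in>I. x + y \<in> I) \<and> (\<forall>x\<in>I. \<forall>y. y * x \<in> I \<and> x * y \<in> I)" (is "?l \<longleftrightarrow> ?r")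
proof
  assume ?l
  then interpret ideal I ring_of_type_algebra .
  show ?r
    using additive_subgroup.zero_closed[OF is_additive_subgroup]
      additive_subgroup.a_closed[OF is_additive_subgroup] I_l_closed I_r_closed
    by (auto simp: ring_of_type_algebra_simps)
next
  assume r: ?r
  have minus: "- x \<in> I" if "x \<in> I" for x
    using r that by (metis mult_minus1)
  interpret ring "ring_of_type_algebra :: 'a ring" by (rule ring_ring_of_type_algebra)
  show ?l
  proof (rule idealI)
    show "subgroup I (add_monoid ring_of_type_algebra)"
      by (rule add.subgroupI)
        (use r minus in \<open>auto simp: ring_of_type_algebra_simps a_inv_ring_of_type_algebra\<close>)
  qed (use r in \<open>auto simp: ring_of_type_algebra_simps ring_ring_of_type_algebra\<close>)
qed

section \<open>Scalars, coefficients and products in the free algebra\<close>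

abbreviation scalar :: "'k::field \<Rightarrow> ('v list \<Rightarrow>\<^sub>0 'k)" where
  "scalar \<equiv> Poly_Mapping.single []"

lemma single_append_mult:
  "Poly_Mapping.single v a * Poly_Mapping.single w b = Poly_Mapping.single (v @ w) (a * b)"
  for v w :: "'v list"
  by (simp add: mult_single plus_list_def)

lemma scalar_one: "scalar 1 = 1"
  by (metis zero_list_def single_one)

lemma scalar_mult: "scalar a * scalar b = scalar (a * b)"
  by (simp add: single_append_mult)

lemma lookup_scalar_mult:
  "Poly_Mapping.lookup (scalar c * u) w = c * Poly_Mapping.lookup u w"
  by (induction u rule: poly_mapping_sum_induct)
    (auto simp: single_append_mult lookup_single lookup_add distrib_left when_def)

text \<open>The empty word is neutral for concatenation and \<open>k\<close> is commutative, so the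
  copy of \<open>k\<close> in the free algebra is central.\<close>

lemma scalar_commute: "u * scalar c = scalar c * u"
  by (induction u rule: poly_mapping_sum_induct)
    (simp_all add: single_append_mult mult.commute distrib_left distrib_right)

lemma keys_scalar_mult: "Poly_Mapping.keys (scalar c * u) \<subseteq> Poly_Mapping.keys u"
  by (auto simp: in_keys_iff lookup_scalar_mult)

lemma keys_mult_list:
  "Poly_Mapping.keys (u * v) \<subseteq> {x @ y | x y. x \<in> Poly_Mapping.keys u \<and> y \<in> Poly_Mapping.keys v}"
  for u v :: "'v list \<Rightarrow>\<^sub>0 'k::field"
  using keys_mult[of u v] by (auto simp: plus_list_def)

text \<open>All words in the support of \<open>u\<close> are as long as \<open>w\<close>, so
  \<open>w @ w'\<close> can be cut in only one way into a word of \<open>u\<close> followed by a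
  word of \<open>v\<close>, and the convolution sum collapses to one product.\<close>

lemma lookup_mult_append:
  fixes u v :: "'v list \<Rightarrow>\<^sub>0 'k::field"
  assumes "\<forall>x\<in>Poly_Mapping.keys u. length x = length w"
  shows "Poly_Mapping.lookup (u * v) (w @ w') = Poly_Mapping.lookup u w * Poly_Mapping.lookup v w'"
proof -
  have *: "Poly_Mapping.lookup (Poly_Mapping.single x c * v) (w @ w') =
      Poly_Mapping.lookup (Poly_Mapping.single x c) w * Poly_Mapping.lookup v w'"
    if "length x = length w" for x c
    using that by (induction v rule: poly_mapping_sum_induct)
      (auto simp: single_append_mult lookup_single lookup_add distrib_left when_def)
  have "u = (\<Sum>x\<in>Poly_Mapping.keys u. Poly_Mapping.single x (Poly_Mapping.lookup u x))"
    by (rule poly_mapping_eqI)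
      (auto simp: lookup_sum lookup_single when_def in_keys_iff sum.delta' intro: sum.neutral)
  then have "Poly_Mapping.lookup (u * v) (w @ w') = Poly_Mapping.lookup
      ((\<Sum>x\<in>Poly_Mapping.keys u. Poly_Mapping.single x (Poly_Mapping.lookup u x)) * v) (w @ w')"
    by (rule arg_cong)
  also have "\<dots> =
      (\<Sum>x\<in>Poly_Mapping.keys u. Poly_Mapping.lookup (Poly_Mapping.single x (Poly_Mapping.lookup u x) * v) (w @ w'))"
    by (simp only: sum_distrib_right lookup_sum)
  also have "\<dots> = (\<Sum>x\<in>Poly_Mapping.keys u.
      Poly_Mapping.lookup (Poly_Mapping.single x (Poly_Mapping.lookup u x)) w * Poly_Mapping.lookup v w')"
    using assms by (intro sum.cong) (auto simp: *)
  also have "\<dots> = Poly_Mapping.lookup u w * Poly_Mapping.lookup v w'"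
    by (auto simp: lookup_single when_def in_keys_iff sum.delta' simp flip: sum_distrib_right)
  finally show ?thesis .
qed


section \<open>Normal forms in the tensor algebra\<close>

lemma ideal_linearity_ideal: "ideal (linearity_ideal scale) ring_of_type_algebra"
  unfolding linearity_ideal_def
  by (rule ring.genideal_ideal[OF ring_ring_of_type_algebra]) (simp add: ring_of_type_algebra_simps)

lemmas linearity_ideal_closed =
  ideal_linearity_ideal[unfolded ideal_ring_of_type_algebra_iff, THEN conjunct1]
  ideal_linearity_ideal[unfolded ideal_ring_of_type_algebra_iff, THEN conjunct2, THEN conjunct1, rule_format]
  ideal_linearity_ideal[unfolded ideal_ring_of_type_algebra_iff, THEN conjunct2, THEN conjunct2, rule_format, THEN conjunct1]
  ideal_linearity_ideal[unfolded ideal_ring_of_type_algebra_iff, THEN conjunct2, THEN conjunct2, rule_format, THEN conjunct2]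

lemma linearity_ideal_minus: "x \<in> linearity_ideal scale \<Longrightarrow> - x \<in> linearity_ideal scale"
  using linearity_ideal_closed(3)[of x scale "- 1"] by simp

lemma linearity_ideal_generators:
  "Poly_Mapping.single [x + y] 1 - Poly_Mapping.single [x] 1 - Poly_Mapping.single [y] 1
     \<in> linearity_ideal scale"
  "Poly_Mapping.single [scale c x] 1 - Poly_Mapping.single [x] c \<in> linearity_ideal scale"
  unfolding linearity_ideal_def
  by (rule subsetD[OF ring.genideal_self[OF ring_ring_of_type_algebra]];
      force simp: ring_of_type_algebra_simps)+

section \<open>The tensor algebra as a ring of cosets\<close>

lemma tensor_coset_eq_iff:
  fixes scale :: "'k::field \<Rightarrow> 'v::ab_group_add \<Rightarrow> 'v"
  shows "tensor_coset scale u = tensor_coset scale v \<longleftrightarrow> u - v \<in> linearity_ideal scale"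
proof -
  let ?F = "ring_of_type_algebra :: ('v list \<Rightarrow>\<^sub>0 'k) ring"
  interpret ideal "linearity_ideal scale" ?F by (rule ideal_linearity_ideal)
  show ?thesis
    unfolding tensor_coset_def
    using quotient_eq_iff_same_a_r_cos[OF ideal_axioms, of u v]
    by (simp add: ring_of_type_algebra_simps a_minus_def a_inv_ring_of_type_algebra)
qed

lemma carrier_tensor_algebra: "carrier (tensor_algebra scale) = range (tensor_coset scale)"
  by (simp add: tensor_algebra_def Let_def FactRing_def A_RCOSETS_def' tensor_coset_def
      ring_of_type_algebra_simps UNION_singleton_eq_range)

lemma tensor_coset_hom:
  fixes scale :: "'k::field \<Rightarrow> 'v::ab_group_add \<Rightarrow> 'v"
  shows "tensor_coset scale u \<otimes>\<^bsub>tensor_algebra scale\<^esub> tensor_coset scale v = tensor_coset scale (u * v)"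
  "tensor_coset scale u \<oplus>\<^bsub>tensor_algebra scale\<^esub> tensor_coset scale v = tensor_coset scale (u + v)"
  "\<one>\<^bsub>tensor_algebra scale\<^esub> = tensor_coset scale 1"
  "\<zero>\<^bsub>tensor_algebra scale\<^esub> = tensor_coset scale 0"
  "c \<odot>\<^bsub>tensor_algebra scale\<^esub> tensor_coset scale u = tensor_coset scale (scalar c * u)"
proof -
  let ?F = "ring_of_type_algebra :: ('v list \<Rightarrow>\<^sub>0 'k) ring"
  interpret ideal "linearity_ideal scale" ?F by (rule ideal_linearity_ideal)
  show m: "tensor_coset scale u \<otimes>\<^bsub>tensor_algebra scale\<^esub> tensor_coset scale v = tensor_coset scale (u * v)" for u v
    using rcoset_mult_add[of u v]
    by (simp add: tensor_algebra_def Let_def FactRing_def tensor_coset_def ring_of_type_algebra_simps)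
  show "tensor_coset scale u \<oplus>\<^bsub>tensor_algebra scale\<^esub> tensor_coset scale v = tensor_coset scale (u + v)"
    using a_rcos_sum[of u v]
    by (simp add: tensor_algebra_def Let_def FactRing_def tensor_coset_def ring_of_type_algebra_simps)
  show "\<one>\<^bsub>tensor_algebra scale\<^esub> = tensor_coset scale 1"
    by (simp add: tensor_algebra_def Let_def FactRing_def tensor_coset_def ring_of_type_algebra_simps)
  show "\<zero>\<^bsub>tensor_algebra scale\<^esub> = tensor_coset scale 0"
    using a_rcos_zero[OF ideal_axioms, of 0] linearity_ideal_closed(1)[of scale]
    by (simp add: tensor_algebra_def Let_def FactRing_def tensor_coset_def ring_of_type_algebra_simps)
  show "c \<odot>\<^bsub>tensor_algebra scale\<^esub> tensor_coset scale u = tensor_coset scale (scalar c * u)"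
    using m[of "scalar c" u] by (simp add: tensor_algebra_def Let_def)
qed

lemma ring_tensor_algebra: "ring (tensor_algebra scale)"
proof (rule ringI)
  show "abelian_group (tensor_algebra scale)"
  proof (rule abelian_groupI)
    fix x
    assume "x \<in> carrier (tensor_algebra scale)"
    then obtain u where u: "x = tensor_coset scale u" by (auto simp: carrier_tensor_algebra)
    show "\<exists>y\<in>carrier (tensor_algebra scale). y \<oplus>\<^bsub>tensor_algebra scale\<^esub> x = \<zero>\<^bsub>tensor_algebra scale\<^esub>"
      by (rule bexI[of _ "tensor_coset scale (- u)"])
        (simp_all add: u carrier_tensor_algebra tensor_coset_hom)
  qed (auto simp: carrier_tensor_algebra tensor_coset_hom ac_simps)
  show "Group.monoid (tensor_algebra scale)"
    by (rule monoidI) (auto simp: carrier_tensor_algebra tensor_coset_hom mult.assoc)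
qed (auto simp: carrier_tensor_algebra tensor_coset_hom algebra_simps)

section \<open>Normal forms relative to a basis of \<open>V\<close>\<close>

locale vector_space_basis = vector_space scale
  for scale :: "'k::field \<Rightarrow> 'v::ab_group_add \<Rightarrow> 'v" +
  fixes B :: "'v set"
  assumes independent_basis: "independent B" and span_basis: "span B = UNIV"
begin

definition letter_nf :: "'v \<Rightarrow> ('v list \<Rightarrow>\<^sub>0 'k)" where
  "letter_nf v = (\<Sum>b | representation B v b \<noteq> 0. Poly_Mapping.single [b] (representation B v b))"

definition word_nf :: "'v list \<Rightarrow> ('v list \<Rightarrow>\<^sub>0 'k)" where
  "word_nf w = prod_list (map letter_nf w)"

text \<open>This is the algebra endomorphism of the free algebra that expands each letter in the
  basis \<open>B\<close>. Its kernel turns out to be \<open>linearity_ideal\<close>, so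
  \<open>nf u\<close> is a canonical representative of the coset of \<open>u\<close>.\<close>

definition nf :: "('v list \<Rightarrow>\<^sub>0 'k) \<Rightarrow> ('v list \<Rightarrow>\<^sub>0 'k)" where
  "nf u = (\<Sum>w\<in>Poly_Mapping.keys u. scalar (Poly_Mapping.lookup u w) * word_nf w)"

text \<open>The degree \<open>p\<close> part of the free algebra on \<open>B\<close>: a copy of the
  \<open>p\<close>-th tensor power of \<open>V\<close> in which elements can be compared by their
  coefficients.\<close>

definition basis_words :: "nat \<Rightarrow> ('v list \<Rightarrow>\<^sub>0 'k) set" where
  "basis_words p = {u. \<forall>w\<in>Poly_Mapping.keys u. set w \<subseteq> B \<and> length w = p}"

lemma lookup_letter_nf:
  "Poly_Mapping.lookup (letter_nf v) w = (if length w = 1 then representation B v (hd w) else 0)"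
proof -
  have f: "finite {b. representation B v b \<noteq> 0}" by (rule finite_representation)
  show ?thesis
  proof (cases "length w = 1")
    case True
    then obtain b where b: "w = [b]" by (metis One_nat_def length_0_conv length_Suc_conv)
    show ?thesis
      unfolding letter_nf_def b lookup_sum lookup_single when_def
      using f by (auto simp: sum.delta')
  next
    case False
    then show ?thesis
      unfolding letter_nf_def lookup_sum lookup_single when_def
      by (auto intro!: sum.neutral)
  qed
qed

lemma letter_nf_add: "letter_nf (x + y) = letter_nf x + letter_nf y"
  by (rule poly_mapping_eqI)
    (simp add: lookup_letter_nf lookup_add representation_add[OF independent_basis] span_basis)

lemma letter_nf_scale: "letter_nf (scale c x) = scalar c * letter_nf x"
  by (rule poly_mapping_eqI)
    (simp add: lookup_letter_nf lookup_scalar_mult representation_scale[OF independent_basis] span_basis)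

text \<open>Allows \<open>nf u\<close>, \<open>nf v\<close> and \<open>nf (u + v)\<close> to be
  written over one common index set.\<close>

lemma nf_superset:
  assumes "finite K" "Poly_Mapping.keys u \<subseteq> K"
  shows "nf u = (\<Sum>w\<in>K. scalar (Poly_Mapping.lookup u w) * word_nf w)"
  unfolding nf_def using assms by (intro sum.mono_neutral_left) (auto simp: in_keys_iff)

lemma nf_add: "nf (u + v) = nf u + nf v"
proof -
  let ?K = "Poly_Mapping.keys u \<union> Poly_Mapping.keys v"
  have "nf (u + v) = (\<Sum>w\<in>?K. scalar (Poly_Mapping.lookup (u + v) w) * word_nf w)"
    by (rule nf_superset) (simp_all add: Poly_Mapping.keys_add)
  also have "\<dots> = nf u + nf v"
    by (simp add: nf_superset[of ?K u] nf_superset[of ?K v] lookup_add single_add distrib_right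
        sum.distrib)
  finally show ?thesis .
qed

lemma nf_zero: "nf 0 = 0"
  by (simp add: nf_def)

lemma nf_minus: "nf (- u) = - nf u"
  using nf_add[of u "- u"] by (simp add: nf_zero eq_neg_iff_add_eq_0 add.commute)

lemma nf_diff: "nf (u - v) = nf u - nf v"
  using nf_add[of u "- v"] by (simp add: nf_minus)

lemma nf_single: "nf (Poly_Mapping.single w c) = scalar c * word_nf w"
  by (cases "c = 0") (simp_all add: nf_def)

text \<open>By additivity in both factors it is enough to multiply monomials. There
  \<open>word_nf\<close> is multiplicative, and the scalar of the second factor moves past
  \<open>word_nf x\<close> because scalars are central.\<close>

lemma nf_mult: "nf (u * v) = nf u * nf v"
proof (induction u rule: poly_mapping_sum_induct)
  case zero
  then show ?case by (simp add: nf_zero)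
next
  case (single x a)
  show ?case
  proof (induction v rule: poly_mapping_sum_induct)
    case (single y b)
    have "nf (Poly_Mapping.single x a * Poly_Mapping.single y b)
        = scalar (a * b) * (word_nf x * word_nf y)"
      by (simp add: single_append_mult nf_single word_nf_def)
    also have "\<dots> = scalar a * (scalar b * word_nf x) * word_nf y"
      by (simp only: scalar_mult[symmetric] mult.assoc)
    also have "scalar b * word_nf x = word_nf x * scalar b"
      by (rule scalar_commute[symmetric])
    finally show ?case by (simp add: nf_single mult.assoc)
  qed (simp_all add: nf_zero nf_add distrib_left)
next
  case (add u v)
  then show ?case by (simp add: nf_add distrib_right)
qed

text \<open>The zero set of \<open>nf\<close> is an ideal and contains both kinds of generators,
  since coordinates in \<open>B\<close> are linear; the generated ideal is the least such
  ideal.\<close>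

lemma nf_linearity_ideal: "u \<in> linearity_ideal scale \<Longrightarrow> nf u = 0"
proof -
  have "ideal {u. nf u = 0} ring_of_type_algebra"
    by (auto simp: ideal_ring_of_type_algebra_iff nf_zero nf_add nf_mult)
  moreover have "nf (Poly_Mapping.single [x + y] 1 - Poly_Mapping.single [x] 1 - Poly_Mapping.single [y] 1) = 0" for x y
    by (simp add: nf_diff nf_single word_nf_def letter_nf_add scalar_one)
  moreover have "nf (Poly_Mapping.single [scale c x] 1 - Poly_Mapping.single [x] c) = 0" for c x
    by (simp add: nf_diff nf_single word_nf_def letter_nf_scale scalar_one)
  ultimately have "linearity_ideal scale \<subseteq> {u. nf u = 0}"
    unfolding linearity_ideal_def
    by (intro ring.genideal_minimal[OF ring_ring_of_type_algebra]) auto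
  then show "u \<in> linearity_ideal scale \<Longrightarrow> nf u = 0" by auto
qed

text \<open>The basis expansion of \<open>v\<close> is assembled one summand at a time; each step
  uses one generator for sums and one for scalar multiples.\<close>

lemma letter_diff_letter_nf: "Poly_Mapping.single [v] 1 - letter_nf v \<in> linearity_ideal scale"
proof -
  let ?L = "linearity_ideal scale"
  \<comment> \<open>The empty expansion is the vector \<open>0\<close>, whose one-letter word is a
    nonzero monomial. It lies in the ideal because the generator for \<open>0 + 0\<close> is its
    negative.\<close>
  have zero: "Poly_Mapping.single [0] 1 \<in> ?L"
    using linearity_ideal_minus[OF linearity_ideal_generators(1)[of 0 0 scale]] by simp
  have sum: "Poly_Mapping.single [\<Sum>b\<in>I. scale (c b) b] 1 - (\<Sum>b\<in>I. Poly_Mapping.single [b] (c b)) \<in> ?L"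
    if "finite I" for I c
    using that
  proof induction
    case (insert x F)
    have "Poly_Mapping.single [\<Sum>b\<in>insert x F. scale (c b) b] 1 -
        (\<Sum>b\<in>insert x F. Poly_Mapping.single [b] (c b)) =
      (Poly_Mapping.single [scale (c x) x + (\<Sum>b\<in>F. scale (c b) b)] 1 - Poly_Mapping.single [scale (c x) x] 1
        - Poly_Mapping.single [\<Sum>b\<in>F. scale (c b) b] 1)
      + (Poly_Mapping.single [scale (c x) x] 1 - Poly_Mapping.single [x] (c x))
      + (Poly_Mapping.single [\<Sum>b\<in>F. scale (c b) b] 1 - (\<Sum>b\<in>F. Poly_Mapping.single [b] (c b)))"
      using insert by simp
    then show ?case
      by (simp only: linearity_ideal_closed(2) linearity_ideal_generators insert.IH)
  qed (use zero in simp)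
  have "(\<Sum>b | representation B v b \<noteq> 0. scale (representation B v b) b) = v"
    by (rule sum_nonzero_representation_eq[OF independent_basis]) (simp add: span_basis)
  then show ?thesis
    unfolding letter_nf_def
    using sum[OF finite_representation[of B v], of "representation B v"] by simp
qed

text \<open>Telescoping: first the head letter is replaced by its expansion, then the rest of the
  word, and each replacement changes the product by a multiple of an element of the ideal.\<close>

lemma word_diff_word_nf: "Poly_Mapping.single w 1 - word_nf w \<in> linearity_ideal scale"
proof (induction w)
  case Nil
  then show ?case by (simp add: word_nf_def scalar_one linearity_ideal_closed)
next
  case (Cons v w)
  have "Poly_Mapping.single (v # w) 1 = Poly_Mapping.single [v] 1 * Poly_Mapping.single w (1::'k)"
    by (simp add: single_append_mult)
  then have "Poly_Mapping.single (v # w) 1 - word_nf (v # w) =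
      (Poly_Mapping.single [v] 1 - letter_nf v) * Poly_Mapping.single w 1
      + letter_nf v * (Poly_Mapping.single w 1 - word_nf w)"
    by (simp add: word_nf_def algebra_simps)
  then show ?case
    using letter_diff_letter_nf Cons by (simp add: linearity_ideal_closed)
qed

lemma diff_nf: "u - nf u \<in> linearity_ideal scale"
proof (induction u rule: poly_mapping_sum_induct)
  case zero
  then show ?case by (simp add: nf_zero linearity_ideal_closed)
next
  case (single w c)
  have "Poly_Mapping.single w c - nf (Poly_Mapping.single w c)
      = scalar c * (Poly_Mapping.single w 1 - word_nf w)"
    by (simp add: nf_single right_diff_distrib single_append_mult)
  then show ?case by (simp add: linearity_ideal_closed word_diff_word_nf)
next
  case (add u v)
  have "(u + v) - nf (u + v) = (u - nf u) + (v - nf v)" by (simp add: nf_add)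
  then show ?case by (simp only: linearity_ideal_closed(2) add)
qed

lemma tensor_coset_nf: "tensor_coset scale (nf u) = tensor_coset scale u"
  using linearity_ideal_minus[OF diff_nf[of u]] by (simp add: tensor_coset_eq_iff)

text \<open>\<open>nf\<close> kills the ideal, and \<open>u - nf u\<close> lies in it, so the ideal
  is exactly the kernel of \<open>nf\<close>.\<close>

lemma tensor_coset_eq_iff_nf: "tensor_coset scale u = tensor_coset scale v \<longleftrightarrow> nf u = nf v"
proof
  assume "tensor_coset scale u = tensor_coset scale v"
  then show "nf u = nf v"
    using nf_linearity_ideal[of "u - v"] by (simp add: tensor_coset_eq_iff nf_diff)
next
  assume "nf u = nf v"
  then show "tensor_coset scale u = tensor_coset scale v" by (metis tensor_coset_nf)
qed

lemma keys_word_nf: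
  "w' \<in> Poly_Mapping.keys (word_nf w) \<Longrightarrow> set w' \<subseteq> B \<and> length w' = length w"
proof (induction w arbitrary: w')
  case Nil
  then show ?case by (simp add: word_nf_def zero_list_def)
next
  case (Cons v w)
  then obtain x y where xy: "w' = x @ y" "x \<in> Poly_Mapping.keys (letter_nf v)"
      "y \<in> Poly_Mapping.keys (word_nf w)"
    using keys_mult_list[of "letter_nf v" "word_nf w"] by (auto simp: word_nf_def)
  then have "length x = 1" "representation B v (hd x) \<noteq> 0"
    by (auto simp: in_keys_iff lookup_letter_nf split: if_splits)
  moreover from this have "hd x \<in> B" using representation_ne_zero by blast
  ultimately have "set x \<subseteq> B" "length x = 1"
    by (auto simp: length_Suc_conv)
  then show ?case using Cons.IH[OF xy(3)] xy(1) by auto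
qed

lemma nf_basis_words:
  assumes "\<forall>w\<in>Poly_Mapping.keys u. length w = p"
  shows "nf u \<in> basis_words p"
proof -
  have "set w' \<subseteq> B \<and> length w' = p" if "w' \<in> Poly_Mapping.keys (nf u)" for w'
  proof -
    from that obtain w where "w \<in> Poly_Mapping.keys u"
        "w' \<in> Poly_Mapping.keys (scalar (Poly_Mapping.lookup u w) * word_nf w)"
      unfolding nf_def using Poly_Mapping.keys_sum by fast
    then show ?thesis
      using keys_word_nf keys_scalar_mult assms by fast
  qed
  then show ?thesis by (auto simp: basis_words_def)
qed

lemma word_nf_basis: "set w \<subseteq> B \<Longrightarrow> word_nf w = Poly_Mapping.single w 1"
proof (induction w)
  case Nil
  then show ?case by (simp add: word_nf_def scalar_one)
next
  case (Cons v w)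
  have "letter_nf v = Poly_Mapping.single [v] 1"
  proof (rule poly_mapping_eqI)
    fix w
    have "v \<in> B" using Cons.prems by simp
    then show "Poly_Mapping.lookup (letter_nf v) w = Poly_Mapping.lookup (Poly_Mapping.single [v] 1) w"
      by (cases w) (auto simp: lookup_letter_nf lookup_single when_def
        representation_basis[OF independent_basis])
  qed
  then show ?case using Cons by (simp add: word_nf_def single_append_mult)
qed

lemma nf_eq_self:
  assumes "u \<in> basis_words p"
  shows "nf u = u"
proof -
  have "nf u = (\<Sum>w\<in>Poly_Mapping.keys u. Poly_Mapping.single w (Poly_Mapping.lookup u w))"
    unfolding nf_def
    using assms by (intro sum.cong) (auto simp: word_nf_basis single_append_mult basis_words_def)
  also have "\<dots> = u"
    by (rule poly_mapping_eqI)
      (auto simp: lookup_sum lookup_single when_def in_keys_iff sum.delta' intro: sum.neutral)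
  finally show ?thesis .
qed

lemma tensor_power_eq: "tensor_power scale p = tensor_coset scale ` basis_words p"
proof
  show "tensor_power scale p \<subseteq> tensor_coset scale ` basis_words p"
    unfolding tensor_power_def
    by (auto intro!: image_eqI[where f = "tensor_coset scale", OF tensor_coset_nf[symmetric]] nf_basis_words)
  show "tensor_coset scale ` basis_words p \<subseteq> tensor_power scale p"
    unfolding tensor_power_def basis_words_def by auto
qed

text \<open>\<open>nf\<close> fixes \<open>basis_words p\<close> pointwise. Through this
  injectivity, equations and intersections in \<open>T(V)\<close> are lifted to the free
  algebra.\<close>

lemma inj_on_tensor_coset: "inj_on (tensor_coset scale) (basis_words p)"
  by (rule inj_onI) (simp add: tensor_coset_eq_iff_nf nf_eq_self)

end

section \<open>Spans of products\<close>

text \<open>Linear subspaces of the free algebra, with \<open>k\<close> acting by left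
  multiplication with \<open>scalar c\<close>; negatives come from \<open>c = - 1\<close>.\<close>

definition scalar_closed :: "('v list \<Rightarrow>\<^sub>0 'k::field) set \<Rightarrow> bool" where
  "scalar_closed U \<longleftrightarrow> 0 \<in> U \<and> (\<forall>x\<in>U. \<forall>y\<in>U. x + y \<in> U) \<and> (\<forall>c. \<forall>x\<in>U. scalar c * x \<in> U)"

lemma scalar_closedD:
  assumes "scalar_closed U"
  shows "0 \<in> U" "x \<in> U \<Longrightarrow> y \<in> U \<Longrightarrow> x + y \<in> U" "x \<in> U \<Longrightarrow> scalar c * x \<in> U"
  using assms by (auto simp: scalar_closed_def)

lemma scalar_closed_sum:
  assumes "scalar_closed U" "\<And>i. i \<in> I \<Longrightarrow> x i \<in> U"
  shows "sum x I \<in> U"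
  using assms(2) by (induction I rule: infinite_finite_induct) (auto simp: scalar_closedD[OF assms(1)])

lemma scalar_closed_uminus:
  assumes "scalar_closed U" "x \<in> U"
  shows "- x \<in> U"
proof -
  have "scalar (- 1) * x = - x"
    by (rule poly_mapping_eqI) (simp add: lookup_scalar_mult)
  then show ?thesis using scalar_closedD(3)[OF assms] by metis
qed

text \<open>The counterpart of \<open>tensor_span\<close> before passage to cosets. Adding one
  product at a time matches induction on the number of summands.\<close>

inductive_set product_span :: "('v list \<Rightarrow>\<^sub>0 'k::field) set \<Rightarrow> ('v list \<Rightarrow>\<^sub>0 'k) set \<Rightarrow> ('v list \<Rightarrow>\<^sub>0 'k) set"
  for S S' where
  zero: "0 \<in> product_span S S'"
| add: "z \<in> product_span S S' \<Longrightarrow> a \<in> S \<Longrightarrow> b \<in> S' \<Longrightarrow> z + a * b \<in> product_span S S'"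

lemma product_span_plus:
  assumes "x \<in> product_span S S'" "y \<in> product_span S S'"
  shows "x + y \<in> product_span S S'"
  using assms(2)
  by induction (auto simp: assms(1) product_span.add simp flip: add.assoc)

lemma product_span_mult: "a \<in> S \<Longrightarrow> b \<in> S' \<Longrightarrow> a * b \<in> product_span S S'"
  using product_span.add[OF product_span.zero] by force

lemma product_span_sum:
  "(\<And>i. i \<in> I \<Longrightarrow> x i \<in> product_span S S') \<Longrightarrow> sum x I \<in> product_span S S'"
  by (induction I rule: infinite_finite_induct) (auto simp: product_span.zero product_span_plus)

text \<open>Each product absorbs the scalar into its left factor.\<close>

lemma scalar_closed_product_span:
  assumes "scalar_closed S"
  shows "scalar_closed (product_span S S')"
proof -
  have "scalar c * x \<in> product_span S S'" if "x \<in> product_span S S'" for c x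
    using that
  proof induction
    case (add z a b)
    then have "scalar c * z + (scalar c * a) * b \<in> product_span S S'"
      by (intro product_span.add scalar_closedD(3)[OF assms])
    then show ?case by (simp add: distrib_left mult.assoc)
  qed (simp add: product_span.zero)
  then show ?thesis by (auto simp: scalar_closed_def product_span.zero product_span_plus)
qed

lemma tensor_span_image:
  fixes scale :: "'k::field \<Rightarrow> 'v::ab_group_add \<Rightarrow> 'v"
  shows "tensor_span (tensor_algebra scale) (tensor_coset scale ` S) (tensor_coset scale ` S') =
    tensor_coset scale ` product_span S S'"
proof -
  let ?T = "tensor_algebra scale" and ?c = "tensor_coset scale"
  interpret T: ring ?T by (rule ring_tensor_algebra)
  have "finsum ?T (\<lambda>i. a i \<otimes>\<^bsub>?T\<^esub> b i) {..<m} \<in> ?c ` product_span S S'"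
    if "\<forall>i<m. a i \<in> ?c ` S \<and> b i \<in> ?c ` S'" for m :: nat and a b
    using that
  proof (induction m)
    case 0
    then show ?case by (auto simp: tensor_coset_hom product_span.zero)
  next
    case (Suc m)
    have "a m \<in> ?c ` S" "b m \<in> ?c ` S'" using Suc.prems by auto
    moreover have "finsum ?T (\<lambda>i. a i \<otimes>\<^bsub>?T\<^esub> b i) {..<m} \<in> ?c ` product_span S S'"
      by (rule Suc.IH) (use Suc.prems in auto)
    ultimately obtain x y z where xyz: "x \<in> S" "a m = ?c x" "y \<in> S'" "b m = ?c y"
      "z \<in> product_span S S'" "finsum ?T (\<lambda>i. a i \<otimes>\<^bsub>?T\<^esub> b i) {..<m} = ?c z"
      by blast
    have ab: "a i \<otimes>\<^bsub>?T\<^esub> b i \<in> carrier ?T" if "i < Suc m" for i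
      using Suc.prems that by (intro T.m_closed) (auto simp: carrier_tensor_algebra)
    have "finsum ?T (\<lambda>i. a i \<otimes>\<^bsub>?T\<^esub> b i) {..<Suc m} = a m \<otimes>\<^bsub>?T\<^esub> b m \<oplus>\<^bsub>?T\<^esub> finsum ?T (\<lambda>i. a i \<otimes>\<^bsub>?T\<^esub> b i) {..<m}"
      unfolding lessThan_Suc by (rule T.finsum_insert) (use ab in auto)
    also have "\<dots> = ?c (z + x * y)"
      by (simp add: xyz tensor_coset_hom add.commute)
    finally show ?case using product_span.add[OF xyz(5,1,3)] by blast
  qed
  then have "tensor_span ?T (?c ` S) (?c ` S') \<subseteq> ?c ` product_span S S'"
    by (auto simp only: tensor_span_def mem_Collect_eq subset_iff)
  moreover have "\<exists>(m::nat) a b. ?c z = finsum ?T (\<lambda>i. a i \<otimes>\<^bsub>?T\<^esub> b i) {..<m} \<and>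
      (\<forall>i<m. a i \<in> ?c ` S \<and> b i \<in> ?c ` S')" if "z \<in> product_span S S'" for z
    using that
  proof induction
    case zero
    then show ?case by (intro exI[of _ 0]) (simp add: tensor_coset_hom)
  next
    case (add z x y)
    then obtain m :: nat and a b where h: "\<forall>i<m. a i \<in> ?c ` S \<and> b i \<in> ?c ` S'"
        "?c z = finsum ?T (\<lambda>i. a i \<otimes>\<^bsub>?T\<^esub> b i) {..<m}" by blast
    \<comment> \<open>The new product is appended at index \<open>m\<close>; the old summands have
      smaller indices and are unaffected.\<close>
    let ?a = "a(m := ?c x)" and ?b = "b(m := ?c y)"
    have ab: "a i \<otimes>\<^bsub>?T\<^esub> b i \<in> carrier ?T" if "i < m" for i
      using h(1) that by (intro T.m_closed) (auto simp: carrier_tensor_algebra)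
    have "finsum ?T (\<lambda>i. ?a i \<otimes>\<^bsub>?T\<^esub> ?b i) {..<Suc m} =
        ?a m \<otimes>\<^bsub>?T\<^esub> ?b m \<oplus>\<^bsub>?T\<^esub> finsum ?T (\<lambda>i. ?a i \<otimes>\<^bsub>?T\<^esub> ?b i) {..<m}"
      unfolding lessThan_Suc by (rule T.finsum_insert)
        (use ab in \<open>auto simp: tensor_coset_hom carrier_tensor_algebra\<close>)
    also have "finsum ?T (\<lambda>i. ?a i \<otimes>\<^bsub>?T\<^esub> ?b i) {..<m} = finsum ?T (\<lambda>i. a i \<otimes>\<^bsub>?T\<^esub> b i) {..<m}"
      by (rule T.finsum_cong') (use ab in auto)
    also have "?a m \<otimes>\<^bsub>?T\<^esub> ?b m \<oplus>\<^bsub>?T\<^esub> finsum ?T (\<lambda>i. a i \<otimes>\<^bsub>?T\<^esub> b i) {..<m} = ?c (z + x * y)"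
      by (simp flip: h(2) add: tensor_coset_hom add.commute)
    finally have "?c (z + x * y) = finsum ?T (\<lambda>i. ?a i \<otimes>\<^bsub>?T\<^esub> ?b i) {..<Suc m}" ..
    moreover have "\<forall>i<Suc m. ?a i \<in> ?c ` S \<and> ?b i \<in> ?c ` S'"
      using h(1) add by (auto simp: less_Suc_eq)
    ultimately show ?case by blast
  qed
  then have "?c ` product_span S S' \<subseteq> tensor_span ?T (?c ` S) (?c ` S')"
    unfolding tensor_span_def by (intro image_subsetI) (simp only: mem_Collect_eq)
  ultimately show ?thesis by (rule antisym)
qed


section \<open>Contractions and the Koszul spaces\<close>

definition homogeneous :: "nat \<Rightarrow> ('v list \<Rightarrow>\<^sub>0 'k::field) set" where
  "homogeneous p = {u. \<forall>w\<in>Poly_Mapping.keys u. length w = p}"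

text \<open>On words in a basis this is the contraction of the last tensor factor with the
  coordinate functional at \<open>b\<close>. \<open>map_key\<close> pulls coefficients back along
  the injective map that appends \<open>b\<close>.\<close>

definition right_contraction :: "'v \<Rightarrow> ('v list \<Rightarrow>\<^sub>0 'k::field) \<Rightarrow> ('v list \<Rightarrow>\<^sub>0 'k)" where
  "right_contraction b = Poly_Mapping.map_key (\<lambda>w. w @ [b])"

definition left_contraction :: "'v \<Rightarrow> ('v list \<Rightarrow>\<^sub>0 'k::field) \<Rightarrow> ('v list \<Rightarrow>\<^sub>0 'k)" where
  "left_contraction b = Poly_Mapping.map_key (\<lambda>w. b # w)"

lemma lookup_right_contraction:
  "Poly_Mapping.lookup (right_contraction b u) w = Poly_Mapping.lookup u (w @ [b])"
  unfolding right_contraction_def by (subst map_key.rep_eq) (auto simp: inj_def)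

lemma lookup_left_contraction:
  "Poly_Mapping.lookup (left_contraction b u) w = Poly_Mapping.lookup u (b # w)"
  unfolding left_contraction_def by (subst map_key.rep_eq) (auto simp: inj_def)

lemma contraction_zero: "right_contraction b 0 = 0" "left_contraction b 0 = 0"
  by (rule poly_mapping_eqI; simp add: lookup_right_contraction lookup_left_contraction)+

lemma contraction_add:
  "right_contraction b (u + v) = right_contraction b u + right_contraction b v"
  "left_contraction b (u + v) = left_contraction b u + left_contraction b v"
  by (rule poly_mapping_eqI; simp add: lookup_right_contraction lookup_left_contraction lookup_add)+

lemma homogeneous_mult:
  "u \<in> homogeneous p \<Longrightarrow> v \<in> homogeneous q \<Longrightarrow> u * v \<in> homogeneous (p + q)"
  using keys_mult_list[of u v] by (fastforce simp: homogeneous_def)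

lemma lookup_homogeneous: "u \<in> homogeneous p \<Longrightarrow> length w \<noteq> p \<Longrightarrow> Poly_Mapping.lookup u w = 0"
  by (auto simp: homogeneous_def in_keys_iff)

lemma contraction_homogeneous:
  assumes "u \<in> homogeneous (Suc p)"
  shows "right_contraction b u \<in> homogeneous p" "left_contraction b u \<in> homogeneous p"
proof -
  have "length (w @ [b]) = Suc p" if "Poly_Mapping.lookup u (w @ [b]) \<noteq> 0" for w
    using assms that unfolding homogeneous_def in_keys_iff mem_Collect_eq Ball_def by blast
  moreover have "length (b # w) = Suc p" if "Poly_Mapping.lookup u (b # w) \<noteq> 0" for w
    using assms that unfolding homogeneous_def in_keys_iff mem_Collect_eq Ball_def by blast
  ultimately show "right_contraction b u \<in> homogeneous p" "left_contraction b u \<in> homogeneous p"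
    by (auto simp: homogeneous_def in_keys_iff lookup_right_contraction lookup_left_contraction)
qed

lemma lookup_mult_append_homogeneous:
  assumes "u \<in> homogeneous p" "length w = p"
  shows "Poly_Mapping.lookup (u * v) (w @ w') = Poly_Mapping.lookup u w * Poly_Mapping.lookup v w'"
  using assms by (intro lookup_mult_append) (auto simp: homogeneous_def)

text \<open>Words of \<open>v\<close> are nonempty, so the last letter of a word in the product
  comes from \<open>v\<close>, and the contraction passes over \<open>u\<close>.\<close>

lemma right_contraction_mult:
  assumes "u \<in> homogeneous p" "v \<in> homogeneous (Suc q)"
  shows "right_contraction b (u * v) = u * right_contraction b v"
proof (rule poly_mapping_eqI)
  fix w
  show "Poly_Mapping.lookup (right_contraction b (u * v)) w = Poly_Mapping.lookup (u * right_contraction b v) w"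
  proof (cases "length w = p + q")
    case True
    define w1 w2 where "w1 = take p w" and "w2 = drop p w"
    then have w: "w = w1 @ w2" "length w1 = p" using True by auto
    show ?thesis
      unfolding lookup_right_contraction w(1) append_assoc
      by (simp add: lookup_mult_append_homogeneous[OF assms(1) w(2)] lookup_right_contraction)
  next
    \<comment> \<open>In every other degree both coefficients vanish by homogeneity.\<close>
    case False
    then show ?thesis
      using lookup_homogeneous[OF homogeneous_mult[OF assms], of "w @ [b]"]
        lookup_homogeneous[OF homogeneous_mult[OF assms(1) contraction_homogeneous(1)[OF assms(2)]], of w b]
      by (simp add: lookup_right_contraction)
  qed
qed

lemma left_contraction_mult:
  assumes "u \<in> homogeneous (Suc p)" "v \<in> homogeneous q"
  shows "left_contraction b (u * v) = left_contraction b u * v"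
proof (rule poly_mapping_eqI)
  fix w
  have c: "left_contraction b u \<in> homogeneous p" by (rule contraction_homogeneous[OF assms(1)])
  show "Poly_Mapping.lookup (left_contraction b (u * v)) w = Poly_Mapping.lookup (left_contraction b u * v) w"
  proof (cases "length w = p + q")
    case True
    define w1 w2 where "w1 = take p w" and "w2 = drop p w"
    then have w: "w = w1 @ w2" "length w1 = p" using True by auto
    show ?thesis
      unfolding lookup_left_contraction w(1) append_Cons[symmetric]
      by (simp add: lookup_mult_append_homogeneous[OF c w(2)] lookup_left_contraction
          lookup_mult_append_homogeneous[OF assms(1), of "b # w1"] w(2) del: append_Cons)
  next
    case False
    then show ?thesis
      using lookup_homogeneous[OF homogeneous_mult[OF assms], of "b # w"]
        lookup_homogeneous[OF homogeneous_mult[OF c assms(2)], of w]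
      by (simp add: lookup_left_contraction)
  qed
qed

text \<open>The words of \<open>u\<close>, nonempty by the degree assumption, are grouped by their
  last letter. Indexing by the last letters that occur keeps the sum finite.\<close>

lemma right_contraction_sum:
  assumes "u \<in> homogeneous (Suc p)"
  shows "u = (\<Sum>b\<in>last ` Poly_Mapping.keys u. right_contraction b u * Poly_Mapping.single [b] 1)"
proof (rule poly_mapping_eqI)
  fix w
  let ?C = "last ` Poly_Mapping.keys u"
  have s: "Poly_Mapping.single [b] 1 \<in> homogeneous 1" for b :: 'a
    by (simp add: homogeneous_def)
  have h: "right_contraction b u * Poly_Mapping.single [b] 1 \<in> homogeneous (Suc p)" for b
    using homogeneous_mult[OF contraction_homogeneous(1)[OF assms] s] by simp
  show "Poly_Mapping.lookup u w = Poly_Mapping.lookup (\<Sum>b\<in>?C. right_contraction b u * Poly_Mapping.single [b] 1) w"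
  proof (cases "length w = Suc p")
    case True
    then obtain w1 c where w: "w = w1 @ [c]" "length w1 = p"
      by (cases w rule: rev_cases) auto
    have "Poly_Mapping.lookup (right_contraction b u * Poly_Mapping.single [b] 1) w =
        (if b = c then Poly_Mapping.lookup u w else 0)" for b
      unfolding w(1)
      by (simp add: lookup_mult_append_homogeneous[OF contraction_homogeneous(1)[OF assms] w(2)]
          lookup_right_contraction lookup_single when_def)
    moreover have "c \<in> ?C" if "Poly_Mapping.lookup u w \<noteq> 0"
      using that w(1) by (force simp: in_keys_iff)
    ultimately show ?thesis by (auto simp: lookup_sum)
  next
    case False
    then show ?thesis
      by (simp add: lookup_sum lookup_homogeneous[OF h] lookup_homogeneous[OF assms])
  qed
qed

lemma left_contraction_sum:
  assumes "u \<in> homogeneous (Suc p)"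
  shows "u = (\<Sum>b\<in>hd ` Poly_Mapping.keys u. Poly_Mapping.single [b] 1 * left_contraction b u)"
proof (rule poly_mapping_eqI)
  fix w
  let ?C = "hd ` Poly_Mapping.keys u"
  have s: "Poly_Mapping.single [b] 1 \<in> homogeneous 1" for b :: 'a
    by (simp add: homogeneous_def)
  have h: "Poly_Mapping.single [b] 1 * left_contraction b u \<in> homogeneous (Suc p)" for b
    using homogeneous_mult[OF s contraction_homogeneous(2)[OF assms]] by simp
  show "Poly_Mapping.lookup u w = Poly_Mapping.lookup (\<Sum>b\<in>?C. Poly_Mapping.single [b] 1 * left_contraction b u) w"
  proof (cases "length w = Suc p")
    case True
    then obtain c w1 where w: "w = [c] @ w1" by (cases w) auto
    have "Poly_Mapping.lookup (Poly_Mapping.single [b] 1 * left_contraction b u) w =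
        (if b = c then Poly_Mapping.lookup u w else 0)" for b
      unfolding w
      by (subst lookup_mult_append_homogeneous[OF s])
        (simp_all add: lookup_left_contraction lookup_single when_def)
    moreover have "c \<in> ?C" if "Poly_Mapping.lookup u w \<noteq> 0"
      using that w by (force simp: in_keys_iff)
    ultimately show ?thesis by (auto simp: lookup_sum)
  next
    case False
    then show ?thesis
      by (simp add: lookup_sum lookup_homogeneous[OF h] lookup_homogeneous[OF assms])
  qed
qed

lemma product_span_homogeneous:
  assumes "S \<subseteq> homogeneous p" "S' \<subseteq> homogeneous q"
  shows "product_span S S' \<subseteq> homogeneous (p + q)"
proof
  fix z
  assume "z \<in> product_span S S'"
  then show "z \<in> homogeneous (p + q)"
  proof induction
    case (add z a b)
    then have "a * b \<in> homogeneous (p + q)" using assms by (auto intro: homogeneous_mult)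
    then show ?case
      using add.IH Poly_Mapping.keys_add[of z "a * b"] by (auto simp: homogeneous_def)
  qed (simp add: homogeneous_def)
qed

text \<open>The contraction acts on right factors alone, so any set it maps \<open>S'\<close> into
  can take the place of \<open>S'\<close>.\<close>

lemma right_contraction_product_span:
  assumes "z \<in> product_span S S'"
    and "S \<subseteq> homogeneous p" "S' \<subseteq> homogeneous (Suc q)"
    and "\<And>v. v \<in> S' \<Longrightarrow> right_contraction b v \<in> S''"
  shows "right_contraction b z \<in> product_span S S''"
  using assms(1)
proof induction
  case (add z u v)
  then have "right_contraction b (u * v) = u * right_contraction b v"
    using assms(2,3) by (intro right_contraction_mult) auto
  then show ?case
    using add assms(4) by (simp add: contraction_add product_span.add)
qed (simp add: contraction_zero product_span.zero)

lemma left_contraction_product_span: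
  assumes "z \<in> product_span S S'"
    and "S \<subseteq> homogeneous (Suc p)" "S' \<subseteq> homogeneous q"
    and "\<And>u. u \<in> S \<Longrightarrow> left_contraction b u \<in> S''"
  shows "left_contraction b z \<in> product_span S'' S'"
  using assms(1)
proof induction
  case (add z u v)
  then have "left_contraction b (u * v) = left_contraction b u * v"
    using assms(2,3) by (intro left_contraction_mult) auto
  then show ?case
    using add assms(4) by (simp add: contraction_add product_span.add)
qed (simp add: contraction_zero product_span.zero)

section \<open>Koszul spaces in normal form\<close>

context vector_space_basis
begin

lemma basis_words_homogeneous: "basis_words p \<subseteq> homogeneous p"
  by (auto simp: basis_words_def homogeneous_def)

lemma scalar_closed_basis_words: "scalar_closed (basis_words p)"
  unfolding scalar_closed_def
proof (intro conjI ballI allI)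
  show "x + y \<in> basis_words p" if "x \<in> basis_words p" "y \<in> basis_words p" for x y
    using that Poly_Mapping.keys_add[of x y] by (fastforce simp: basis_words_def)
  show "scalar c * x \<in> basis_words p" if "x \<in> basis_words p" for c x
    using that keys_scalar_mult[of c x] by (fastforce simp: basis_words_def)
qed (simp add: basis_words_def)

lemma product_span_basis_words:
  assumes "S \<subseteq> basis_words p" "S' \<subseteq> basis_words q"
  shows "product_span S S' \<subseteq> basis_words (p + q)"
proof
  fix z
  assume "z \<in> product_span S S'"
  then show "z \<in> basis_words (p + q)"
  proof induction
    case zero
    show ?case by (rule scalar_closedD[OF scalar_closed_basis_words])
  next
    case (add z a b)
    then have "a \<in> basis_words p" "b \<in> basis_words q" using assms by auto
    then have "a * b \<in> basis_words (p + q)"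
      using keys_mult_list[of a b] by (fastforce simp: basis_words_def)
    then show ?case using add.IH by (rule scalar_closedD(2)[OF scalar_closed_basis_words, rotated])
  qed
qed

lemma contraction_basis_words:
  assumes "u \<in> basis_words (Suc p)"
  shows "right_contraction b u \<in> basis_words p" "left_contraction b u \<in> basis_words p"
proof -
  have "set (w @ [b]) \<subseteq> B \<and> length (w @ [b]) = Suc p" if "Poly_Mapping.lookup u (w @ [b]) \<noteq> 0" for w
    using assms that unfolding basis_words_def in_keys_iff mem_Collect_eq Ball_def by blast
  moreover have "set (b # w) \<subseteq> B \<and> length (b # w) = Suc p" if "Poly_Mapping.lookup u (b # w) \<noteq> 0" for w
    using assms that unfolding basis_words_def in_keys_iff mem_Collect_eq Ball_def by blast
  ultimately show "right_contraction b u \<in> basis_words p" "left_contraction b u \<in> basis_words p"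
    by (auto simp: basis_words_def in_keys_iff lookup_right_contraction lookup_left_contraction)
qed

text \<open>\<open>koszul_space\<close> rebuilt from representatives supported on basis words, with
  \<open>R\<close> replaced by such representatives of its elements. Contractions are defined on the
  free algebra and not on cosets, so they are applied here.\<close>

definition koszul_nf :: "('v list \<Rightarrow>\<^sub>0 'k) set set \<Rightarrow> nat \<Rightarrow> ('v list \<Rightarrow>\<^sub>0 'k) set" where
  "koszul_nf R p =
     (if p < 2 then basis_words p
      else \<Inter>(i, j)\<in>{(i, j). i + 2 + j = p}.
        product_span (product_span (basis_words i) {r \<in> basis_words 2. tensor_coset scale r \<in> R})
          (basis_words j))"

lemma koszul_nf_basis_words: "koszul_nf R p \<subseteq> basis_words p"
proof (cases "p < 2")
  case False
  define q where "q = p - 2"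
  have p: "p = q + 2" using False by (simp add: q_def)
  \<comment> \<open>Any single member of the family bounds the intersection; here it is the one with
    \<open>i = q\<close>, \<open>j = 0\<close>.\<close>
  have "koszul_nf R p \<subseteq> product_span (product_span (basis_words q)
      {r \<in> basis_words 2. tensor_coset scale r \<in> R}) (basis_words 0)"
    unfolding koszul_nf_def using p by auto
  also have "\<dots> \<subseteq> basis_words ((q + 2) + 0)"
    by (intro product_span_basis_words) auto
  finally show ?thesis using p by simp
qed (simp add: koszul_nf_def)

text \<open>Spans of products commute with taking cosets by \<open>tensor_span_image\<close>. The
  intersection does so because all its members lie in \<open>basis_words p\<close>, where taking
  cosets is injective.\<close>

lemma koszul_space_eq:
  assumes "quadratic_relations scale R"
  shows "koszul_space scale R p = tensor_coset scale ` koszul_nf R p"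
proof (cases "p < 2")
  case False
  define q where "q = p - 2"
  have p: "p = q + 2" using False by (simp add: q_def)
  let ?R = "{r \<in> basis_words 2. tensor_coset scale r \<in> R}"
  let ?P = "\<lambda>i j. product_span (product_span (basis_words i) ?R) (basis_words j)"
  have R: "R = tensor_coset scale ` ?R"
    using assms by (auto simp: quadratic_relations_def tensor_power_eq)
  have sub: "?P i j \<subseteq> basis_words p" if "i + 2 + j = p" for i j
    using product_span_basis_words[OF product_span_basis_words[of "basis_words i" i ?R 2], of "basis_words j" j] that
    by auto
  have "koszul_space scale R p = (\<Inter>(i, j)\<in>{(i, j). i + 2 + j = p}. tensor_coset scale ` ?P i j)"
    using False
    by (simp add: koszul_space_def tensor_power_eq tensor_span_image flip: R)
      (subst R, simp add: tensor_span_image)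
  also have "\<dots> = (\<Inter>x\<in>{(i, j). i + 2 + j = p}. tensor_coset scale ` (case x of (i, j) \<Rightarrow> ?P i j))"
    by (simp add: case_prod_beta)
  \<comment> \<open>The pair \<open>(0, q)\<close> witnesses that the index set of the intersection
    is nonempty.\<close>
  also have "\<dots> = tensor_coset scale ` (\<Inter>x\<in>{(i, j). i + 2 + j = p}. case x of (i, j) \<Rightarrow> ?P i j)"
    by (rule image_INT[symmetric, OF inj_on_tensor_coset[of p], where j = "(0, q)"])
      (use sub p in auto)
  finally show ?thesis using False by (simp add: koszul_nf_def)
qed (simp add: koszul_space_def koszul_nf_def tensor_power_eq)

lemma scalar_closed_koszul_nf: "scalar_closed (koszul_nf R p)"
proof -
  have "scalar_closed (product_span (product_span (basis_words i) U) (basis_words j))" for U i j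
    by (intro scalar_closed_product_span scalar_closed_basis_words)
  then show ?thesis
    using scalar_closed_basis_words by (auto simp: koszul_nf_def scalar_closed_def)
qed

text \<open>For the member \<open>(i, j)\<close> of the intersection in degree \<open>p\<close>,
  read \<open>u\<close> in the member \<open>(i, j + 1)\<close> to remove the last letter and in
  \<open>(i + 1, j)\<close> to remove the first. The letter then comes from a factor
  \<open>V\<close>, and the factor \<open>R\<close> stays untouched.\<close>

lemma contraction_koszul_nf:
  assumes "u \<in> koszul_nf R (Suc p)"
  shows "right_contraction b u \<in> koszul_nf R p" "left_contraction b u \<in> koszul_nf R p"
proof -
  let ?R = "{r \<in> basis_words 2. tensor_coset scale r \<in> R}"
  let ?P = "\<lambda>i j. product_span (product_span (basis_words i) ?R) (basis_words j)"
  have u: "u \<in> basis_words (Suc p)" using assms koszul_nf_basis_words by blast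
  have R: "?R \<subseteq> homogeneous 2" using basis_words_homogeneous by blast
  have hP: "product_span (basis_words i) ?R \<subseteq> homogeneous (i + 2)" for i
    by (rule product_span_homogeneous[OF basis_words_homogeneous R])
  have "right_contraction b u \<in> ?P i j \<and> left_contraction b u \<in> ?P i j"
    if "i + 2 + j = p" for i j
  proof
    have "u \<in> ?P i (Suc j)" "u \<in> ?P (Suc i) j"
      using assms that by (auto simp: koszul_nf_def split: if_splits)
    from this(1) show "right_contraction b u \<in> ?P i j"
      by (rule right_contraction_product_span[OF _ hP basis_words_homogeneous])
        (rule contraction_basis_words)
    from \<open>u \<in> ?P (Suc i) j\<close> show "left_contraction b u \<in> ?P i j"
      \<comment> \<open>One application enters the outer span and the next the inner one, where the
        contraction meets \<open>basis_words (Suc i)\<close>.\<close>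
      by (rule left_contraction_product_span[OF _ hP[of "Suc i", unfolded add_Suc] basis_words_homogeneous])
        (rule left_contraction_product_span[OF _ basis_words_homogeneous R]; (assumption | rule contraction_basis_words))
  qed
  then show "right_contraction b u \<in> koszul_nf R p" "left_contraction b u \<in> koszul_nf R p"
    using contraction_basis_words[OF u] by (auto simp: koszul_nf_def)
qed

lemma single_basis_words: "b \<in> B \<Longrightarrow> Poly_Mapping.single [b] 1 \<in> basis_words 1"
  by (simp add: basis_words_def)

text \<open>An element is the sum of its contractions times the letters removed. The contractions
  lie in the preceding space, and the letters lie in \<open>B\<close> because the words do.\<close>

lemma koszul_nf_Suc_subset:
  "koszul_nf R (Suc p) \<subseteq> product_span (koszul_nf R p) (basis_words 1)"
  "koszul_nf R (Suc p) \<subseteq> product_span (basis_words 1) (koszul_nf R p)"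
proof -
  have *: "u \<in> product_span (koszul_nf R p) (basis_words 1) \<and> u \<in> product_span (basis_words 1) (koszul_nf R p)"
    if "u \<in> koszul_nf R (Suc p)" for u
  proof -
    have u: "u \<in> basis_words (Suc p)" using that koszul_nf_basis_words by blast
    then have h: "u \<in> homogeneous (Suc p)" using basis_words_homogeneous by blast
    have keys: "set w \<subseteq> B \<and> w \<noteq> []" if "w \<in> Poly_Mapping.keys u" for w
      using u that by (auto simp: basis_words_def)
    have "(\<Sum>b\<in>last ` Poly_Mapping.keys u. right_contraction b u * Poly_Mapping.single [b] 1)
        \<in> product_span (koszul_nf R p) (basis_words 1)"
      using keys
      by (intro product_span_sum product_span_mult contraction_koszul_nf[OF that] single_basis_words)
        fastforce
    moreover have "(\<Sum>b\<in>hd ` Poly_Mapping.keys u. Poly_Mapping.single [b] 1 * left_contraction b u)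
        \<in> product_span (basis_words 1) (koszul_nf R p)"
      using keys
      by (intro product_span_sum product_span_mult contraction_koszul_nf[OF that] single_basis_words)
        (fastforce dest: hd_in_set)
    ultimately show ?thesis
      using right_contraction_sum[OF h] left_contraction_sum[OF h] by metis
  qed
  then show "koszul_nf R (Suc p) \<subseteq> product_span (koszul_nf R p) (basis_words 1)"
    "koszul_nf R (Suc p) \<subseteq> product_span (basis_words 1) (koszul_nf R p)"
    by blast+
qed

lemma koszul_space_Suc_subset:
  assumes "quadratic_relations scale R"
  shows "koszul_space scale R (Suc p) \<subseteq>
      tensor_span (tensor_algebra scale) (koszul_space scale R p) (tensor_power scale 1)"
    and "koszul_space scale R (Suc p) \<subseteq>
      tensor_span (tensor_algebra scale) (tensor_power scale 1) (koszul_space scale R p)"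
  unfolding koszul_space_eq[OF assms] tensor_power_eq tensor_span_image
  using koszul_nf_Suc_subset by (metis image_mono)+

end

section \<open>Maps induced on spans of products\<close>

text \<open>The target is only a commutative monoid, so preservation of the unit is a separate
  assumption.\<close>

lemma hom_finprod_eq:
  assumes "comm_monoid G" "comm_monoid H" "\<phi> \<in> hom G H" "\<phi> \<one>\<^bsub>G\<^esub> = \<one>\<^bsub>H\<^esub>"
    and "f \<in> A \<rightarrow> carrier G"
  shows "finprod H (\<lambda>i. \<phi> (f i)) A = \<phi> (finprod G f A)"
proof -
  interpret G: Group.comm_monoid G by fact
  interpret H: Group.comm_monoid H by fact
  have \<phi>: "\<phi> x \<in> carrier H" if "x \<in> carrier G" for x
    using assms(3) that by (auto simp: hom_def)
  show ?thesis
    using assms(5)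
  proof (induction A rule: infinite_finite_induct)
    case (insert x F)
    then have "f \<in> F \<rightarrow> carrier G" "f x \<in> carrier G" by auto
    moreover from this have "(\<lambda>i. \<phi> (f i)) \<in> F \<rightarrow> carrier H" using \<phi> by auto
    ultimately show ?case
      using insert \<phi> assms(3) by (simp add: hom_mult)
  qed (simp_all add: assms(4))
qed

section \<open>Independence of the sums from the decomposition\<close>

context abelian_group
begin

text \<open>\<open>\<beta>\<close> is a balanced biadditive map on representatives. Since
  \<open>S\<close> lies in a single degree, coefficients of a product \<open>a * b\<close> with
  \<open>a\<close> in \<open>S\<close> factor at position \<open>p\<close>.\<close>

context
  fixes S S' :: "('v list \<Rightarrow>\<^sub>0 'k::field) set" and \<beta> :: "('v list \<Rightarrow>\<^sub>0 'k) \<Rightarrow> ('v list \<Rightarrow>\<^sub>0 'k) \<Rightarrow> 'a"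
    and p :: nat
  assumes S: "scalar_closed S" "S \<subseteq> homogeneous p" and S': "scalar_closed S'"
    and \<beta>_closed: "\<And>x y. x \<in> S \<Longrightarrow> y \<in> S' \<Longrightarrow> \<beta> x y \<in> carrier G"
    and \<beta>_add_left: "\<And>x x' y. x \<in> S \<Longrightarrow> x' \<in> S \<Longrightarrow> y \<in> S' \<Longrightarrow> \<beta> (x + x') y = \<beta> x y \<oplus> \<beta> x' y"
    and \<beta>_add_right: "\<And>x y y'. x \<in> S \<Longrightarrow> y \<in> S' \<Longrightarrow> y' \<in> S' \<Longrightarrow> \<beta> x (y + y') = \<beta> x y \<oplus> \<beta> x y'"
    and \<beta>_balanced: "\<And>c x y. x \<in> S \<Longrightarrow> y \<in> S' \<Longrightarrow> \<beta> (scalar c * x) y = \<beta> x (scalar c * y)"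
begin

lemma biadditive_zero_left: "y \<in> S' \<Longrightarrow> \<beta> 0 y = \<zero>"
  using \<beta>_add_left[of 0 0 y] scalar_closedD(1)[OF S(1)] \<beta>_closed[of 0 y] by simp

lemma biadditive_zero_right: "x \<in> S \<Longrightarrow> \<beta> x 0 = \<zero>"
  using \<beta>_add_right[of x 0 0] scalar_closedD(1)[OF S'] \<beta>_closed[of x 0] by simp

lemma biadditive_sum_right:
  assumes "x \<in> S" "finite J" "\<And>i. i \<in> J \<Longrightarrow> y i \<in> S'"
  shows "\<beta> x (sum y J) = (\<Oplus>i\<in>J. \<beta> x (y i))"
  using assms(2,3)
proof induction
  case empty
  then show ?case using biadditive_zero_right[OF assms(1)] by simp
next
  case (insert j J)
  have "\<beta> x (sum y (insert j J)) = \<beta> x (y j) \<oplus> \<beta> x (sum y J)"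
    using insert by (simp add: \<beta>_add_right assms(1) scalar_closed_sum[OF S'])
  also have "\<dots> = (\<Oplus>i\<in>insert j J. \<beta> x (y i))"
    using insert by (subst finsum_insert) (auto intro!: \<beta>_closed assms(1))
  finally show ?case .
qed

text \<open>As long as some coefficient of some \<open>a j\<close> is nonzero, comparing coefficients expresses
  \<open>b j\<close> as a linear combination of the other \<open>b i\<close>, which shortens the sum by one term.\<close>

lemma balanced_sum_eq_zero:
  assumes "finite I" "\<And>i. i \<in> I \<Longrightarrow> a i \<in> S" "\<And>i. i \<in> I \<Longrightarrow> b i \<in> S'"
    and "(\<Sum>i\<in>I. a i * b i) = 0"
  shows "(\<Oplus>i\<in>I. \<beta> (a i) (b i)) = \<zero>"
  using assms
\<comment> \<open>\<open>a\<close> is generalized because the shortened sum has new left factors;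
  the right factors remain a subfamily of \<open>b\<close>.\<close>
proof (induction "card I" arbitrary: I a)
  case 0
  then show ?case by simp
next
  case (Suc n)
  note a = Suc.prems(2) and b = Suc.prems(3)
  show ?case
  proof (cases "\<forall>i\<in>I. a i = 0")
    case True
    then show ?thesis
      using b by (intro add.finprod_one_eqI) (simp add: biadditive_zero_left)
  next
    case False
    then obtain j where j: "j \<in> I" "a j \<noteq> 0" by blast
    then obtain w where w: "Poly_Mapping.lookup (a j) w \<noteq> 0"
      using poly_mapping_eqI[of "a j" 0] by auto
    then have len: "length w = p"
      using lookup_homogeneous[of "a j" p w] a[OF j(1)] S(2) by blast
    \<comment> \<open>Comparing the coefficients of the vanishing sum at \<open>w @ w'\<close> for
      all \<open>w'\<close> gives a linear relation among the \<open>b i\<close> with coefficients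
      \<open>c i\<close>; \<open>d\<close> is this relation solved for \<open>b j\<close>.\<close>
    define c where "c i = Poly_Mapping.lookup (a i) w" for i
    define d where "d i = - c i / c j" for i
    define J where "J = I - {j}"
    have J: "finite J" "I = insert j J" "j \<notin> J" "n = card J"
      using j(1) Suc.prems(1) Suc.hyps(2) by (auto simp: J_def)
    have cj: "c j \<noteq> 0" using w by (simp add: c_def)
    have "b j = (\<Sum>i\<in>J. scalar (d i) * b i)"
    proof (rule poly_mapping_eqI)
      fix w'
      have "Poly_Mapping.lookup (\<Sum>i\<in>I. a i * b i) (w @ w') = (\<Sum>i\<in>I. c i * Poly_Mapping.lookup (b i) w')"
        unfolding lookup_sum c_def
        using lookup_mult_append_homogeneous[OF _ len] a S(2) by (intro sum.cong) blast+
      then have "c j * Poly_Mapping.lookup (b j) w' = - (\<Sum>i\<in>J. c i * Poly_Mapping.lookup (b i) w')"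
        using Suc.prems(4) J by (simp add: eq_neg_iff_add_eq_0)
      then have "Poly_Mapping.lookup (b j) w' = - (\<Sum>i\<in>J. c i * Poly_Mapping.lookup (b i) w') / c j"
        using cj by (simp add: field_simps)
      also have "\<dots> = (\<Sum>i\<in>J. d i * Poly_Mapping.lookup (b i) w')"
        by (simp add: d_def sum_divide_distrib flip: sum_negf)
      finally show "Poly_Mapping.lookup (b j) w' = Poly_Mapping.lookup (\<Sum>i\<in>J. scalar (d i) * b i) w'"
        by (simp add: lookup_sum lookup_scalar_mult)
    qed
    note bj = this
    \<comment> \<open>Substituting for \<open>b j\<close> and collecting the terms with the same
      \<open>b i\<close> produces these left factors. For \<open>\<beta>\<close>, balancedness moves
      the scalar \<open>d i\<close> across to make the same substitution.\<close>
    define a' where "a' i = a i + scalar (d i) * a j" for i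
    have aJ: "a i \<in> S" "b i \<in> S'" if "i \<in> J" for i using a b that J(2) by auto
    have aj: "a j \<in> S" "b j \<in> S'" using a b j(1) by auto
    have a'J: "a' i \<in> S" if "i \<in> J" for i
      unfolding a'_def by (intro scalar_closedD[OF S(1)] aJ that aj)
    have "(\<Sum>i\<in>J. a' i * b i) = (\<Sum>i\<in>J. a i * b i) + a j * (\<Sum>i\<in>J. scalar (d i) * b i)"
      unfolding a'_def sum_distrib_left sum.distrib[symmetric]
      by (intro sum.cong refl) (simp add: distrib_right mult.assoc[symmetric] scalar_commute)
    also have "\<dots> = 0"
      using Suc.prems(4) J(1-3) by (simp add: add.commute flip: bj)
    finally have "(\<Oplus>i\<in>J. \<beta> (a' i) (b i)) = \<zero>"
      using J a'J aJ by (intro Suc.hyps(1)) auto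
    also have "(\<Oplus>i\<in>J. \<beta> (a' i) (b i)) = (\<Oplus>i\<in>J. \<beta> (a i) (b i) \<oplus> \<beta> (a j) (scalar (d i) * b i))"
      by (intro finsum_cong' refl)
        (simp_all add: a'_def \<beta>_add_left \<beta>_balanced \<beta>_closed aJ aj scalar_closedD(3)[OF S(1)]
          scalar_closedD(3)[OF S'])
    also have "\<dots> = (\<Oplus>i\<in>J. \<beta> (a i) (b i)) \<oplus> (\<Oplus>i\<in>J. \<beta> (a j) (scalar (d i) * b i))"
      using aJ aj by (intro finsum_addf) (auto intro!: \<beta>_closed scalar_closedD[OF S'])
    also have "(\<Oplus>i\<in>J. \<beta> (a j) (scalar (d i) * b i)) = \<beta> (a j) (b j)"
      unfolding bj using aJ aj J by (subst biadditive_sum_right) (auto intro!: scalar_closedD[OF S'])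
    also have "(\<Oplus>i\<in>J. \<beta> (a i) (b i)) \<oplus> \<beta> (a j) (b j) = \<beta> (a j) (b j) \<oplus> (\<Oplus>i\<in>J. \<beta> (a i) (b i))"
      using aJ aj by (intro a_comm finsum_closed \<beta>_closed) (auto intro!: \<beta>_closed)
    also have "\<dots> = (\<Oplus>i\<in>I. \<beta> (a i) (b i))"
      using aJ aj J(1,3) unfolding J(2)
      by (subst finsum_insert) (auto intro!: \<beta>_closed)
    finally show ?thesis .
  qed
qed

text \<open>The difference of the two sums is one vanishing sum over the disjoint union of the index
  sets, with the \<open>a' i\<close> negated.\<close>

lemma balanced_sum_unique:
  assumes "finite I" "\<And>i. i \<in> I \<Longrightarrow> a i \<in> S" "\<And>i. i \<in> I \<Longrightarrow> b i \<in> S'"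
    and "finite I'" "\<And>i. i \<in> I' \<Longrightarrow> a' i \<in> S" "\<And>i. i \<in> I' \<Longrightarrow> b' i \<in> S'"
    and "(\<Sum>i\<in>I. a i * b i) = (\<Sum>i\<in>I'. a' i * b' i)"
  shows "(\<Oplus>i\<in>I. \<beta> (a i) (b i)) = (\<Oplus>i\<in>I'. \<beta> (a' i) (b' i))"
proof -
  have m: "- a' i \<in> S" if "i \<in> I'" for i
    using scalar_closed_uminus[OF S(1)] assms(5) that by blast
  \<comment> \<open>Used for the first family and then for the second family itself. Both sums are
    thus cancelled by the same element and agree, which avoids evaluating \<open>\<beta>\<close> at
    a negated argument.\<close>
  have *: "(\<Oplus>i\<in>I. \<beta> (a i) (b i)) \<oplus> (\<Oplus>i\<in>I'. \<beta> (- a' i) (b' i)) = \<zero>"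
    if "finite I" "\<And>i. i \<in> I \<Longrightarrow> a i \<in> S" "\<And>i. i \<in> I \<Longrightarrow> b i \<in> S'"
      "(\<Sum>i\<in>I. a i * b i) = (\<Sum>i\<in>I'. a' i * b' i)" for I :: "'i set" and a b
  proof -
    let ?a = "case_sum a (\<lambda>i. - a' i)" and ?b = "case_sum b b'"
    have "(\<Oplus>i\<in>I <+> I'. \<beta> (?a i) (?b i)) = \<zero>"
    proof (rule balanced_sum_eq_zero)
      show "(\<Sum>i\<in>I <+> I'. ?a i * ?b i) = 0"
        using that(1,4) assms(4) by (simp add: sum.Plus sum_negf)
    qed (use that assms(4,6) m in auto)
    also have "(\<Oplus>i\<in>I <+> I'. \<beta> (?a i) (?b i)) =
        (\<Oplus>i\<in>Inl ` I. \<beta> (?a i) (?b i)) \<oplus> (\<Oplus>i\<in>Inr ` I'. \<beta> (?a i) (?b i))"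
      unfolding Plus_def using that assms(4,6) m
      by (intro finsum_Un_disjoint) (auto intro!: \<beta>_closed)
    also have "(\<Oplus>i\<in>Inl ` I. \<beta> (?a i) (?b i)) = (\<Oplus>i\<in>I. \<beta> (a i) (b i))"
      using that by (subst finsum_reindex) (auto intro!: \<beta>_closed)
    also have "(\<Oplus>i\<in>Inr ` I'. \<beta> (?a i) (?b i)) = (\<Oplus>i\<in>I'. \<beta> (- a' i) (b' i))"
      using assms(6) m by (subst finsum_reindex) (auto intro!: \<beta>_closed)
    finally show ?thesis .
  qed
  have "(\<Oplus>i\<in>I. \<beta> (a i) (b i)) \<oplus> (\<Oplus>i\<in>I'. \<beta> (- a' i) (b' i)) = \<zero>"
    using * assms by blast
  moreover have "(\<Oplus>i\<in>I'. \<beta> (a' i) (b' i)) \<oplus> (\<Oplus>i\<in>I'. \<beta> (- a' i) (b' i)) = \<zero>"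
    using * assms by blast
  moreover have "(\<Oplus>i\<in>I. \<beta> (a i) (b i)) \<in> carrier G" "(\<Oplus>i\<in>I'. \<beta> (a' i) (b' i)) \<in> carrier G"
    "(\<Oplus>i\<in>I'. \<beta> (- a' i) (b' i)) \<in> carrier G"
    using assms m by (auto intro!: finsum_closed \<beta>_closed)
  ultimately show ?thesis
    using add.right_cancel[of "\<Oplus>i\<in>I'. \<beta> (- a' i) (b' i)" "\<Oplus>i\<in>I. \<beta> (a i) (b i)"
        "\<Oplus>i\<in>I'. \<beta> (a' i) (b' i)"] by simp
qed

end

end

context vector_space_basis
begin

lemma tensor_coset_sum:
  "finite I \<Longrightarrow> tensor_coset scale (sum x I) = finsum (tensor_algebra scale) (\<lambda>i. tensor_coset scale (x i)) I"
proof (induction rule: finite_induct)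
  interpret T: ring "tensor_algebra scale" by (rule ring_tensor_algebra)
  case empty
  show ?case by (simp add: tensor_coset_hom)
next
  interpret T: ring "tensor_algebra scale" by (rule ring_tensor_algebra)
  case (insert i I)
  have "tensor_coset scale (sum x (insert i I)) =
      tensor_coset scale (x i) \<oplus>\<^bsub>tensor_algebra scale\<^esub> tensor_coset scale (sum x I)"
    using insert.hyps by (simp add: tensor_coset_hom)
  then show ?case
    using insert.hyps
    by (subst T.finsum_insert) (simp_all add: carrier_tensor_algebra del: sum.insert flip: insert.IH)
qed

text \<open>Evaluates the definite description in \<open>tensor_lift\<close> at any given
  decomposition of \<open>w\<close>. Uniqueness is established in the additive group
  \<open>M\<close> and carried to \<open>N\<close> by \<open>\<phi>\<close>; this covers values in
  \<open>M\<close> as well as values in a tensor product over \<open>A\<close>.\<close>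

lemma tensor_lift_eq:
  fixes M :: "('m, 'y) ring_scheme" and N :: "('n, 'z) monoid_scheme"
    and \<beta> :: "('v list \<Rightarrow>\<^sub>0 'k) set \<Rightarrow> ('v list \<Rightarrow>\<^sub>0 'k) set \<Rightarrow> 'm"
  defines "T \<equiv> tensor_algebra scale"
  assumes "abelian_group M"
    and S: "scalar_closed S" "S \<subseteq> basis_words p"
    and S': "scalar_closed S'" "S' \<subseteq> basis_words q"
    and eq: "U = tensor_coset scale ` S" "U' = tensor_coset scale ` S'"
    and closed: "\<And>x y. x \<in> U \<Longrightarrow> y \<in> U' \<Longrightarrow> \<beta> x y \<in> carrier M"
    and add_left: "\<And>x x' y. x \<in> U \<Longrightarrow> x' \<in> U \<Longrightarrow> y \<in> U' \<Longrightarrow> \<beta> (x \<oplus>\<^bsub>T\<^esub> x') y = \<beta> x y \<oplus>\<^bsub>M\<^esub> \<beta> x' y"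
    and add_right: "\<And>x y y'. x \<in> U \<Longrightarrow> y \<in> U' \<Longrightarrow> y' \<in> U' \<Longrightarrow> \<beta> x (y \<oplus>\<^bsub>T\<^esub> y') = \<beta> x y \<oplus>\<^bsub>M\<^esub> \<beta> x y'"
    and balanced: "\<And>c x y. x \<in> U \<Longrightarrow> y \<in> U' \<Longrightarrow> \<beta> (c \<odot>\<^bsub>T\<^esub> x) y = \<beta> x (c \<odot>\<^bsub>T\<^esub> y)"
    and N: "comm_monoid N" "\<phi> \<in> hom (add_monoid M) N" "\<phi> \<zero>\<^bsub>M\<^esub> = \<one>\<^bsub>N\<^esub>"
    and \<beta>': "\<And>x y. x \<in> U \<Longrightarrow> y \<in> U' \<Longrightarrow> \<beta>' x y = \<phi> (\<beta> x y)"
    and a: "\<And>i. i < m \<Longrightarrow> a i \<in> U" and b: "\<And>i. i < (m::nat) \<Longrightarrow> b i \<in> U'"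
    and w: "w = finsum T (\<lambda>i. a i \<otimes>\<^bsub>T\<^esub> b i) {..<m}"
  shows "tensor_lift T U U' N \<beta>' w = \<phi> (finsum M (\<lambda>i. \<beta> (a i) (b i)) {..<m})"
proof -
  interpret M: abelian_group M by fact
  let ?c = "tensor_coset scale"
  have prod: "finprod N (\<lambda>i. \<beta>' (a i) (b i)) {..<m} = \<phi> (finsum M (\<lambda>i. \<beta> (a i) (b i)) {..<m})"
    if "\<And>i. i < m \<Longrightarrow> a i \<in> U" "\<And>i. i < m \<Longrightarrow> b i \<in> U'" for m :: nat and a b
  proof -
    have "finprod N (\<lambda>i. \<beta>' (a i) (b i)) {..<m} = finprod N (\<lambda>i. \<phi> (\<beta> (a i) (b i))) {..<m}"
      using that N(2) \<beta>' closed
      by (intro comm_monoid.finprod_cong'[OF N(1)]) (auto simp: hom_def)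
    also have "\<dots> = \<phi> (finsum M (\<lambda>i. \<beta> (a i) (b i)) {..<m})"
      unfolding finsum_def
      by (rule hom_finprod_eq[OF M.a_comm_monoid N(1,2)]) (use N(3) that closed in auto)
    finally show ?thesis .
  qed
  have unique: "finsum M (\<lambda>i. \<beta> (a i) (b i)) {..<m} = finsum M (\<lambda>i. \<beta> (a' i) (b' i)) {..<m'}"
    if h: "\<And>i. i < m \<Longrightarrow> a i \<in> U" "\<And>i. i < m \<Longrightarrow> b i \<in> U'" "\<And>i. i < m' \<Longrightarrow> a' i \<in> U" "\<And>i. i < m' \<Longrightarrow> b' i \<in> U'"
      and sums: "finsum T (\<lambda>i. a i \<otimes>\<^bsub>T\<^esub> b i) {..<m} = finsum T (\<lambda>i. a' i \<otimes>\<^bsub>T\<^esub> b' i) {..<m'}"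
    for m m' :: nat and a b a' b'
  proof -
    \<comment> \<open>Representatives in \<open>S\<close> and \<open>S'\<close> are chosen for all
      factors of both decompositions.\<close>
    obtain x y x' y' where xy:
        "\<And>i. i < m \<Longrightarrow> x i \<in> S \<and> a i = ?c (x i)" "\<And>i. i < m \<Longrightarrow> y i \<in> S' \<and> b i = ?c (y i)"
        "\<And>i. i < m' \<Longrightarrow> x' i \<in> S \<and> a' i = ?c (x' i)" "\<And>i. i < m' \<Longrightarrow> y' i \<in> S' \<and> b' i = ?c (y' i)"
    proof -
      have choice: "\<exists>x. \<forall>i<n. x i \<in> V \<and> u i = ?c (x i)" if "\<And>i. i < n \<Longrightarrow> u i \<in> ?c ` V"
        for n :: nat and u V
      proof -
        have "\<forall>i\<in>{..<n}. \<exists>x. x \<in> V \<and> u i = ?c x" using that by blast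
        from bchoice[OF this] show ?thesis by auto
      qed
      from choice[of m a S] choice[of m b S'] choice[of m' a' S] choice[of m' b' S'] h
      show thesis unfolding eq using that by metis
    qed
    have T: "finsum T (\<lambda>i. u i \<otimes>\<^bsub>T\<^esub> v i) {..<n} = ?c (\<Sum>i<n. f i * g i)"
      if "\<And>i. i < n \<Longrightarrow> u i = ?c (f i)" "\<And>i. i < n \<Longrightarrow> v i = ?c (g i)" for n :: nat and u v f g
    proof -
      interpret T: ring T unfolding T_def by (rule ring_tensor_algebra)
      have "finsum T (\<lambda>i. u i \<otimes>\<^bsub>T\<^esub> v i) {..<n} = finsum T (\<lambda>i. ?c (f i * g i)) {..<n}"
        by (rule T.finsum_cong')
          (auto simp: that T_def tensor_coset_hom carrier_tensor_algebra)
      then show ?thesis by (simp add: tensor_coset_sum T_def)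
    qed
    have in_basis: "(\<Sum>i<n. f i * g i) \<in> basis_words (p + q)"
      if "\<And>i. i < n \<Longrightarrow> f i \<in> S" "\<And>i. i < n \<Longrightarrow> g i \<in> S'" for n :: nat and f g
      using that
      by (intro subsetD[OF product_span_basis_words[OF S(2) S'(2)]] product_span_sum product_span_mult) auto
    have "?c (\<Sum>i<m. x i * y i) = ?c (\<Sum>i<m'. x' i * y' i)"
      using sums T[of m a x b y] T[of m' a' x' b' y'] xy by simp
    \<comment> \<open>Both sums lie in \<open>basis_words (p + q)\<close>, where equal cosets mean
      equal elements, so the uniqueness result for the free algebra becomes applicable.\<close>
    then have eq_sums: "(\<Sum>i<m. x i * y i) = (\<Sum>i<m'. x' i * y' i)"
      by (rule inj_onD[OF inj_on_tensor_coset]) (use xy in \<open>auto intro!: in_basis\<close>)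
    have "finsum M (\<lambda>i. \<beta> (a i) (b i)) {..<m} = finsum M (\<lambda>i. \<beta> (?c (x i)) (?c (y i))) {..<m}"
      by (rule M.finsum_cong') (use xy closed eq in auto)
    also have "\<dots> = finsum M (\<lambda>i. \<beta> (?c (x' i)) (?c (y' i))) {..<m'}"
    proof (rule M.balanced_sum_unique[of S p S' "\<lambda>x y. \<beta> (?c x) (?c y)"])
      show "S \<subseteq> homogeneous p" using S(2) basis_words_homogeneous by blast
      show "\<beta> (?c (u + u')) (?c v) = \<beta> (?c u) (?c v) \<oplus>\<^bsub>M\<^esub> \<beta> (?c u') (?c v)"
        if "u \<in> S" "u' \<in> S" "v \<in> S'" for u u' v
        using add_left[of "?c u" "?c u'" "?c v"] that by (simp add: eq T_def tensor_coset_hom)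
      show "\<beta> (?c u) (?c (v + v')) = \<beta> (?c u) (?c v) \<oplus>\<^bsub>M\<^esub> \<beta> (?c u) (?c v')"
        if "u \<in> S" "v \<in> S'" "v' \<in> S'" for u v v'
        using add_right[of "?c u" "?c v" "?c v'"] that by (simp add: eq T_def tensor_coset_hom)
      show "\<beta> (?c (scalar c * u)) (?c v) = \<beta> (?c u) (?c (scalar c * v))"
        if "u \<in> S" "v \<in> S'" for c u v
        using balanced[of "?c u" "?c v" c] that by (simp add: eq T_def tensor_coset_hom)
    qed (use S S' closed eq xy eq_sums in auto)
    also have "\<dots> = finsum M (\<lambda>i. \<beta> (a' i) (b' i)) {..<m'}"
      by (rule M.finsum_cong') (use h xy closed eq in auto)
    finally show ?thesis .
  qed
  show ?thesis
    unfolding tensor_lift_def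
  proof (rule the_equality, goal_cases)
    case 1
    show ?case
      using a b w prod[of m a b] by (intro exI[of _ m] exI[of _ a] exI[of _ b]) auto
  next
    case (2 n)
    then obtain m' :: nat and a' b' where h: "\<And>i. i < m' \<Longrightarrow> a' i \<in> U" "\<And>i. i < m' \<Longrightarrow> b' i \<in> U'"
        "w = finsum T (\<lambda>i. a' i \<otimes>\<^bsub>T\<^esub> b' i) {..<m'}"
        "n = finprod N (\<lambda>i. \<beta>' (a' i) (b' i)) {..<m'}"
      by blast
    show ?case
      using prod[of m' a' b'] h unique[of m a b m' a' b'] a b w by simp
  qed
qed

end

section \<open>Tensor products over a ring\<close>

lemma hom_free_Abelian_group_diff:
  assumes "group_hom (free_Abelian_group S) K h"
    and "Poly_Mapping.keys x \<subseteq> S" "Poly_Mapping.keys y \<subseteq> S"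
  shows "h (x - y) = h x \<otimes>\<^bsub>K\<^esub> inv\<^bsub>K\<^esub> h y"
proof -
  interpret group_hom "free_Abelian_group S" K h by fact
  have "h (x - y) = h (x \<otimes>\<^bsub>free_Abelian_group S\<^esub> inv\<^bsub>free_Abelian_group S\<^esub> y)"
    using assms by simp
  also have "\<dots> = h x \<otimes>\<^bsub>K\<^esub> h (inv\<^bsub>free_Abelian_group S\<^esub> y)"
    by (intro hom_mult G.inv_closed) (use assms in auto)
  also have "h (inv\<^bsub>free_Abelian_group S\<^esub> y) = inv\<^bsub>K\<^esub> h y"
    by (rule hom_inv) (use assms in auto)
  finally show ?thesis .
qed

lemma keys_diff_subset:
  "Poly_Mapping.keys x \<subseteq> S \<Longrightarrow> Poly_Mapping.keys y \<subseteq> S \<Longrightarrow> Poly_Mapping.keys (x - y) \<subseteq> S"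
  using keys_diff[of x y] by blast

locale bimodule_pair = P: bimodule A P + Q: bimodule A Q
  for A :: "('a, 'z) ring_scheme" and P :: "('a, 'p) bimodule" and Q :: "('a, 'q) bimodule"
begin

abbreviation F where "F \<equiv> free_Abelian_group (carrier P \<times> carrier Q)"

lemma balancing_generators_closed:
  "({frag_of (x \<oplus>\<^bsub>P\<^esub> x', y) - frag_of (x, y) - frag_of (x', y)
         | x x' y. x \<in> carrier P \<and> x' \<in> carrier P \<and> y \<in> carrier Q} \<union>
      {frag_of (x, y \<oplus>\<^bsub>Q\<^esub> y') - frag_of (x, y) - frag_of (x, y')
         | x y y'. x \<in> carrier P \<and> y \<in> carrier Q \<and> y' \<in> carrier Q} \<union>
      {frag_of (ract P x a, y) - frag_of (x, lact Q a y)
         | x a y. x \<in> carrier P \<and> a \<in> carrier A \<and> y \<in> carrier Q}) \<subseteq> carrier F"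
  by (auto dest!: subsetD[OF keys_diff] simp: P.ract_closed Q.lact_closed)

lemma subgroup_balancing: "subgroup (balancing_subgroup A P Q) F"
  unfolding balancing_subgroup_def
  by (rule group.generate_is_subgroup[OF group_free_Abelian_group balancing_generators_closed])

lemma comm_group_tensor_over: "comm_group (tensor_over A P Q)"
  unfolding tensor_over_def
  by (rule comm_group.abelian_FactGroup[OF abelian_free_Abelian_group subgroup_balancing])

lemma group_hom_coset:
  "group_hom F (tensor_over A P Q) (\<lambda>u. balancing_subgroup A P Q #>\<^bsub>F\<^esub> u)"
proof -
  interpret comm_group F by (rule abelian_free_Abelian_group)
  interpret normal "balancing_subgroup A P Q" F
    using subgroup_balancing by (rule subgroup_imp_normal)
  interpret T: comm_group "tensor_over A P Q" by (rule comm_group_tensor_over)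
  show ?thesis
    using r_coset_hom_Mod unfolding tensor_over_def[symmetric]
    by unfold_locales
qed

text \<open>The tensor relations are written as differences; this turns them into equalities of
  cosets.\<close>

lemma coset_balancing_eq:
  assumes "u - v \<in> balancing_subgroup A P Q" "u \<in> carrier F" "v \<in> carrier F"
  shows "balancing_subgroup A P Q #>\<^bsub>F\<^esub> u = balancing_subgroup A P Q #>\<^bsub>F\<^esub> v"
proof -
  have "u = (u - v) \<otimes>\<^bsub>F\<^esub> v" by simp
  then have "u \<in> balancing_subgroup A P Q #>\<^bsub>F\<^esub> v"
    using assms(1) unfolding r_coset_def by blast
  then show ?thesis
    using group.repr_independence[OF group_free_Abelian_group _ assms(3) subgroup_balancing] by metis
qed

lemma pure_tensor_closed:
  "x \<in> carrier P \<Longrightarrow> y \<in> carrier Q \<Longrightarrow> pure_tensor A P Q x y \<in> carrier (tensor_over A P Q)"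
  using group_hom.hom_closed[OF group_hom_coset, of "frag_of (x, y)"]
  by (simp add: pure_tensor_def)

lemma pure_tensor_mult:
  assumes "x \<in> carrier P" "y \<in> carrier Q" "x' \<in> carrier P" "y' \<in> carrier Q"
  shows "pure_tensor A P Q x y \<otimes>\<^bsub>tensor_over A P Q\<^esub> pure_tensor A P Q x' y' =
    balancing_subgroup A P Q #>\<^bsub>F\<^esub> (frag_of (x, y) + frag_of (x', y'))"
  using group_hom.hom_mult[OF group_hom_coset, of "frag_of (x, y)" "frag_of (x', y')"] assms
  by (simp add: pure_tensor_def)

lemma pure_tensor_add_left:
  assumes "x \<in> carrier P" "x' \<in> carrier P" "y \<in> carrier Q"
  shows "pure_tensor A P Q (x \<oplus>\<^bsub>P\<^esub> x') y =
    pure_tensor A P Q x y \<otimes>\<^bsub>tensor_over A P Q\<^esub> pure_tensor A P Q x' y"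
  unfolding pure_tensor_mult[OF assms(1,3,2,3)] unfolding pure_tensor_def
proof (rule coset_balancing_eq)
  show "frag_of (x \<oplus>\<^bsub>P\<^esub> x', y) - (frag_of (x, y) + frag_of (x', y)) \<in> balancing_subgroup A P Q"
    unfolding balancing_subgroup_def diff_diff_add[symmetric]
    by (rule generate.incl) (use assms in blast)
qed (use assms in \<open>auto dest!: subsetD[OF Poly_Mapping.keys_add]\<close>)

lemma pure_tensor_add_right:
  assumes "x \<in> carrier P" "y \<in> carrier Q" "y' \<in> carrier Q"
  shows "pure_tensor A P Q x (y \<oplus>\<^bsub>Q\<^esub> y') =
    pure_tensor A P Q x y \<otimes>\<^bsub>tensor_over A P Q\<^esub> pure_tensor A P Q x y'"
  unfolding pure_tensor_mult[OF assms(1,2,1,3)] unfolding pure_tensor_def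
proof (rule coset_balancing_eq)
  show "frag_of (x, y \<oplus>\<^bsub>Q\<^esub> y') - (frag_of (x, y) + frag_of (x, y')) \<in> balancing_subgroup A P Q"
    unfolding balancing_subgroup_def diff_diff_add[symmetric]
    by (rule generate.incl) (use assms in blast)
qed (use assms in \<open>auto dest!: subsetD[OF Poly_Mapping.keys_add]\<close>)

lemma pure_tensor_balanced:
  assumes "x \<in> carrier P" "a \<in> carrier A" "y \<in> carrier Q"
  shows "pure_tensor A P Q (ract P x a) y = pure_tensor A P Q x (lact Q a y)"
  unfolding pure_tensor_def
proof (rule coset_balancing_eq)
  show "frag_of (ract P x a, y) - frag_of (x, lact Q a y) \<in> balancing_subgroup A P Q"
    unfolding balancing_subgroup_def by (rule generate.incl) (use assms in blast)
qed (use assms in \<open>auto simp: P.ract_closed Q.lact_closed\<close>)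

text \<open>A balanced map factors through the tensor product, hence separates pure tensors.\<close>

lemma pure_tensor_eqD:
  fixes M :: "('m, 'y) ring_scheme"
  assumes "abelian_group M"
    and closed: "\<And>x y. x \<in> carrier P \<Longrightarrow> y \<in> carrier Q \<Longrightarrow> \<beta> x y \<in> carrier M"
    and add_left: "\<And>x x' y. x \<in> carrier P \<Longrightarrow> x' \<in> carrier P \<Longrightarrow> y \<in> carrier Q \<Longrightarrow>
      \<beta> (x \<oplus>\<^bsub>P\<^esub> x') y = \<beta> x y \<oplus>\<^bsub>M\<^esub> \<beta> x' y"
    and add_right: "\<And>x y y'. x \<in> carrier P \<Longrightarrow> y \<in> carrier Q \<Longrightarrow> y' \<in> carrier Q \<Longrightarrow>
      \<beta> x (y \<oplus>\<^bsub>Q\<^esub> y') = \<beta> x y \<oplus>\<^bsub>M\<^esub> \<beta> x y'"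
    and balanced: "\<And>x a y. x \<in> carrier P \<Longrightarrow> a \<in> carrier A \<Longrightarrow> y \<in> carrier Q \<Longrightarrow>
      \<beta> (ract P x a) y = \<beta> x (lact Q a y)"
    and eq: "pure_tensor A P Q x y = pure_tensor A P Q x' y'"
    and carrier: "x \<in> carrier P" "y \<in> carrier Q" "x' \<in> carrier P" "y' \<in> carrier Q"
  shows "\<beta> x y = \<beta> x' y'"
proof -
  interpret M: abelian_group M by fact
  \<comment> \<open>The universal property of the free abelian group extends \<open>\<beta>\<close>
    to a homomorphism. Biadditivity and balancedness say that it kills the generators of
    \<open>balancing_subgroup\<close>.\<close>
  obtain h where h: "h \<in> hom F (add_monoid M)"
    and h_frag: "\<And>z. z \<in> carrier P \<times> carrier Q \<Longrightarrow> h (frag_of z) = (case z of (x, y) \<Rightarrow> \<beta> x y)"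
    by (rule comm_group.free_Abelian_group_universal[OF M.a_comm_group,
          of "\<lambda>(x, y). \<beta> x y" "carrier P \<times> carrier Q"]) (use closed in auto)
  interpret h: group_hom F "add_monoid M" h
    by (intro group_hom.intro group_hom_axioms.intro group_free_Abelian_group M.a_group h)
  have h_diff: "h (u - v) = h u \<ominus>\<^bsub>M\<^esub> h v" if "u \<in> carrier F" "v \<in> carrier F" for u v
    using hom_free_Abelian_group_diff[OF h.group_hom_axioms, of u v] that
    by (simp add: a_minus_def a_inv_def)
  have h_beta: "h (frag_of (x, y)) = \<beta> x y" if "x \<in> carrier P" "y \<in> carrier Q" for x y
    using h_frag that by auto
  have h_diff2: "h (u - v - w) = h u \<ominus>\<^bsub>M\<^esub> h v \<ominus>\<^bsub>M\<^esub> h w"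
    if "u \<in> carrier F" "v \<in> carrier F" "w \<in> carrier F" for u v w
    using that keys_diff_subset[of u _ v] by (simp add: h_diff)
  have zero: "(b \<oplus>\<^bsub>M\<^esub> c) \<ominus>\<^bsub>M\<^esub> b \<ominus>\<^bsub>M\<^esub> c = \<zero>\<^bsub>M\<^esub>" if "b \<in> carrier M" "c \<in> carrier M" for b c
  proof -
    have "(b \<oplus>\<^bsub>M\<^esub> c) \<ominus>\<^bsub>M\<^esub> b \<ominus>\<^bsub>M\<^esub> c = (b \<oplus>\<^bsub>M\<^esub> c) \<oplus>\<^bsub>M\<^esub> \<ominus>\<^bsub>M\<^esub> (b \<oplus>\<^bsub>M\<^esub> c)"
      using that by (simp add: a_minus_def M.a_assoc M.minus_add)
    then show ?thesis using M.r_neg[of "b \<oplus>\<^bsub>M\<^esub> c"] that by simp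
  qed
  have self_zero: "b \<ominus>\<^bsub>M\<^esub> b = \<zero>\<^bsub>M\<^esub>" if "b \<in> carrier M" for b
    using that by (simp add: a_minus_def M.r_neg)
  have "balancing_subgroup A P Q \<subseteq> kernel F (add_monoid M) h"
    unfolding balancing_subgroup_def
  proof (rule h.G.generate_subgroup_incl[OF _ h.subgroup_kernel], rule subsetI, goal_cases)
    case (1 u)
    then have "u \<in> carrier F" using balancing_generators_closed by blast
    moreover have "h u = \<zero>\<^bsub>M\<^esub>"
      using 1
      by (auto simp: h_diff h_diff2 h_beta add_left add_right balanced closed zero
          P.ract_closed Q.lact_closed self_zero)
    ultimately show ?case by (simp add: kernel_def)
  qed
  \<comment> \<open>Equal pure tensors differ by an element of the balancing subgroup, where
    \<open>h\<close> vanishes.\<close>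
  moreover have "frag_of (x, y) \<in> balancing_subgroup A P Q #>\<^bsub>F\<^esub> frag_of (x', y')"
    using h.G.rcos_self[OF _ subgroup_balancing, of "frag_of (x, y)"] eq carrier
    unfolding pure_tensor_def by simp
  then obtain u where "u \<in> balancing_subgroup A P Q" "frag_of (x, y) = u \<otimes>\<^bsub>F\<^esub> frag_of (x', y')"
    unfolding r_coset_def by blast
  ultimately have u: "u \<in> carrier F" "h u = \<zero>\<^bsub>M\<^esub>" "frag_of (x, y) = u \<otimes>\<^bsub>F\<^esub> frag_of (x', y')"
    by (auto simp: kernel_def)
  have "\<beta> x y = h (u \<otimes>\<^bsub>F\<^esub> frag_of (x', y'))"
    using carrier by (simp only: u(3)[symmetric] h_beta)
  also have "\<dots> = h u \<oplus>\<^bsub>M\<^esub> h (frag_of (x', y'))"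
    using h.hom_mult[OF u(1), of "frag_of (x', y')"] carrier by simp
  also have "\<dots> = \<beta> x' y'"
    using carrier by (simp add: u(2) h_beta closed)
  finally show ?thesis .
qed

end

section \<open>Tensoring with the regular bimodule\<close>

lemma bimodule_regular_bimodule:
  assumes "ring A"
  shows "bimodule A (regular_bimodule A)"
proof -
  interpret ring A by fact
  have "abelian_group (regular_bimodule A)"
    by (rule abelian_groupI) (auto simp: regular_bimodule_def a_ac intro: add.l_inv_ex)
  then show ?thesis
    by (intro bimodule.intro bimodule_axioms.intro assms)
      (auto simp: regular_bimodule_def m_assoc l_distr r_distr)
qed

lemma regular_bimodule_simps:
  "carrier (regular_bimodule A) = carrier A" "x \<oplus>\<^bsub>regular_bimodule A\<^esub> y = x \<oplus>\<^bsub>A\<^esub> y"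
  "lact (regular_bimodule A) x y = x \<otimes>\<^bsub>A\<^esub> y" "ract (regular_bimodule A) x y = x \<otimes>\<^bsub>A\<^esub> y"
  by (simp_all add: regular_bimodule_def)

context bimodule
begin

lemma bimodule_pair_left: "bimodule_pair A (regular_bimodule A) M"
  by (intro bimodule_pair.intro bimodule_regular_bimodule bimodule_axioms A.ring_axioms)

lemma bimodule_pair_right: "bimodule_pair A M (regular_bimodule A)"
  by (intro bimodule_pair.intro bimodule_regular_bimodule bimodule_axioms A.ring_axioms)

text \<open>\<open>inv_into\<close> recovers \<open>x\<close> once
  \<open>x \<mapsto> 1 \<otimes> x\<close> is injective. It is, because the left action is a
  balanced map whose value on the pair of \<open>1\<close> and \<open>x\<close> is
  \<open>x\<close>.\<close>

lemma left_unitor_pure_tensor: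
  assumes "x \<in> carrier M"
  shows "left_unitor A M (pure_tensor A (regular_bimodule A) M \<one>\<^bsub>A\<^esub> x) = x"
  unfolding left_unitor_def
proof (rule inv_into_f_f[OF inj_onI assms])
  fix x y
  assume h: "x \<in> carrier M" "y \<in> carrier M" "pure_tensor A (regular_bimodule A) M \<one>\<^bsub>A\<^esub> x = pure_tensor A (regular_bimodule A) M \<one>\<^bsub>A\<^esub> y"
  have "lact M \<one>\<^bsub>A\<^esub> x = lact M \<one>\<^bsub>A\<^esub> y"
    by (rule bimodule_pair.pure_tensor_eqD[OF bimodule_pair_left M.abelian_group_axioms, where \<beta> = "lact M"])
      (use h in \<open>auto simp: regular_bimodule_simps lact_closed lact_l_distr lact_r_distr lact_assoc\<close>)
  then show "x = y" using h lact_one by simp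
qed

lemma right_unitor_pure_tensor:
  assumes "x \<in> carrier M"
  shows "right_unitor A M (pure_tensor A M (regular_bimodule A) x \<one>\<^bsub>A\<^esub>) = x"
  unfolding right_unitor_def
proof (rule inv_into_f_f[OF inj_onI assms])
  fix x y
  assume h: "x \<in> carrier M" "y \<in> carrier M" "pure_tensor A M (regular_bimodule A) x \<one>\<^bsub>A\<^esub> = pure_tensor A M (regular_bimodule A) y \<one>\<^bsub>A\<^esub>"
  have "ract M x \<one>\<^bsub>A\<^esub> = ract M y \<one>\<^bsub>A\<^esub>"
    by (rule bimodule_pair.pure_tensor_eqD[OF bimodule_pair_right M.abelian_group_axioms, where \<beta> = "ract M"])
      (use h in \<open>auto simp: regular_bimodule_simps ract_closed ract_l_distr ract_r_distr ract_assoc\<close>)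
  then show "x = y" using h ract_one by simp
qed

lemma left_pure_tensor_hom:
  "(\<lambda>x. pure_tensor A (regular_bimodule A) M \<one>\<^bsub>A\<^esub> x) \<in> hom (add_monoid M) (tensor_over A (regular_bimodule A) M)"
  using bimodule_pair.pure_tensor_closed[OF bimodule_pair_left]
    bimodule_pair.pure_tensor_add_right[OF bimodule_pair_left]
  by (auto simp: hom_def regular_bimodule_simps)

lemma right_pure_tensor_hom:
  "(\<lambda>x. pure_tensor A M (regular_bimodule A) x \<one>\<^bsub>A\<^esub>) \<in> hom (add_monoid M) (tensor_over A M (regular_bimodule A))"
  using bimodule_pair.pure_tensor_closed[OF bimodule_pair_right]
    bimodule_pair.pure_tensor_add_left[OF bimodule_pair_right]
  by (auto simp: hom_def regular_bimodule_simps)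

text \<open>Moving \<open>a\<close> across the tensor sign brings values of the cup product into the
  form \<open>1 \<otimes> x\<close>, on which \<open>left_unitor\<close> is known.\<close>

lemma pure_tensor_left_one:
  assumes "a \<in> carrier A" "x \<in> carrier M"
  shows "pure_tensor A (regular_bimodule A) M a x = pure_tensor A (regular_bimodule A) M \<one>\<^bsub>A\<^esub> (lact M a x)"
  using bimodule_pair.pure_tensor_balanced[OF bimodule_pair_left, of "\<one>\<^bsub>A\<^esub>" a x] assms
  by (simp add: regular_bimodule_simps)

lemma pure_tensor_right_one:
  assumes "x \<in> carrier M" "a \<in> carrier A"
  shows "pure_tensor A M (regular_bimodule A) x a = pure_tensor A M (regular_bimodule A) (ract M x a) \<one>\<^bsub>A\<^esub>"
  using bimodule_pair.pure_tensor_balanced[OF bimodule_pair_right, of x a "\<one>\<^bsub>A\<^esub>"] assms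
  by (simp add: regular_bimodule_simps)

end

section \<open>The fundamental formula\<close>

lemma tensor_power_carrier: "tensor_power scale p \<subseteq> carrier (tensor_algebra scale)"
  by (auto simp: tensor_power_def carrier_tensor_algebra)

lemma ideal_quadratic_relations:
  assumes "quadratic_relations scale R"
  shows "ideal (Idl\<^bsub>tensor_algebra scale\<^esub> R) (tensor_algebra scale)"
  using assms tensor_power_carrier[of scale 2] unfolding quadratic_relations_def
  by (intro ring.genideal_ideal[OF ring_tensor_algebra]) blast

lemma quadratic_projection_ring_hom:
  assumes "quadratic_relations scale R"
  shows "quadratic_projection scale R \<in> ring_hom (tensor_algebra scale) (quadratic_algebra scale R)"
  using ideal.rcos_ring_hom[OF ideal_quadratic_relations[OF assms]]
  by (simp add: quadratic_projection_def[abs_def] quadratic_algebra_def)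

text \<open>Scalars are central in \<open>T(V)\<close>. The first form balances
  \<open>f(u).x\<close> and the second balances \<open>x.f(u)\<close>.\<close>

lemma quadratic_projection_smult:
  assumes "quadratic_relations scale R" "x \<in> carrier (tensor_algebra scale)"
  shows "quadratic_projection scale R (c \<odot>\<^bsub>tensor_algebra scale\<^esub> x) =
      quadratic_scalar scale R c \<otimes>\<^bsub>quadratic_algebra scale R\<^esub> quadratic_projection scale R x"
    and "quadratic_projection scale R (c \<odot>\<^bsub>tensor_algebra scale\<^esub> x) =
      quadratic_projection scale R x \<otimes>\<^bsub>quadratic_algebra scale R\<^esub> quadratic_scalar scale R c"
proof -
  obtain u where u: "x = tensor_coset scale u" using assms(2) by (auto simp: carrier_tensor_algebra)
  let ?s = "c \<odot>\<^bsub>tensor_algebra scale\<^esub> \<one>\<^bsub>tensor_algebra scale\<^esub>"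
  have "?s \<in> carrier (tensor_algebra scale)"
    by (simp add: tensor_coset_hom carrier_tensor_algebra)
  moreover have "c \<odot>\<^bsub>tensor_algebra scale\<^esub> x = ?s \<otimes>\<^bsub>tensor_algebra scale\<^esub> x"
    "c \<odot>\<^bsub>tensor_algebra scale\<^esub> x = x \<otimes>\<^bsub>tensor_algebra scale\<^esub> ?s"
    by (simp_all add: u tensor_coset_hom scalar_commute)
  ultimately show "quadratic_projection scale R (c \<odot>\<^bsub>tensor_algebra scale\<^esub> x) =
      quadratic_scalar scale R c \<otimes>\<^bsub>quadratic_algebra scale R\<^esub> quadratic_projection scale R x"
    "quadratic_projection scale R (c \<odot>\<^bsub>tensor_algebra scale\<^esub> x) =
      quadratic_projection scale R x \<otimes>\<^bsub>quadratic_algebra scale R\<^esub> quadratic_scalar scale R c"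
    unfolding quadratic_scalar_def
    using ring_hom_mult[OF quadratic_projection_ring_hom[OF assms(1)]] assms(2) by metis+
qed

lemma quadratic_scalar_closed:
  assumes "quadratic_relations scale R"
  shows "quadratic_scalar scale R c \<in> carrier (quadratic_algebra scale R)"
  unfolding quadratic_scalar_def
  by (rule ring_hom_closed[OF quadratic_projection_ring_hom[OF assms]])
    (simp add: tensor_coset_hom carrier_tensor_algebra)

text \<open>The doubled sign disappears since \<open>(- 1) ^ p\<close> squares to \<open>1\<close>;
  the rest is a difference read backwards.\<close>

lemma (in abelian_group) sign_bracket:
  fixes p :: nat
  assumes "x \<in> carrier G" "y \<in> carrier G"
  shows "add_pow G ((- 1 :: int) ^ p) x \<ominus> add_pow G ((- 1 :: int) ^ p) (add_pow G ((- 1 :: int) ^ p) y)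
    = \<ominus> (y \<ominus> add_pow G ((- 1 :: int) ^ p) x)"
proof -
  have "add_pow G ((- 1 :: int) ^ p) (add_pow G ((- 1 :: int) ^ p) y) = add_pow G ((- 1 :: int) ^ p * (- 1) ^ p) y"
    using assms(2) by (rule add.int_pow_pow)
  also have "(- 1 :: int) ^ p * (- 1) ^ p = 1"
    by (simp flip: power_mult_distrib)
  also have "add_pow G (1 :: int) y = y"
    using assms(2) by (rule add.int_pow_1)
  finally show ?thesis
    using assms by (simp add: a_minus_def minus_add a_comm)
qed

theorem theorem3p7:
  fixes scale :: "'k::field \<Rightarrow> 'v::ab_group_add \<Rightarrow> 'v"
    and R :: "('v list \<Rightarrow>\<^sub>0 'k) set set"
    and M :: "(('v list \<Rightarrow>\<^sub>0 'k) set set, 'm) bimodule"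
    and f :: "('v list \<Rightarrow>\<^sub>0 'k) set \<Rightarrow> 'm"
    and p :: nat
  assumes "vector_space scale"
    and "quadratic_relations scale R"
    and "quadratic_bimodule scale R M"
    and "koszul_cochain scale R p M f"
  shows "\<forall>w\<in>koszul_space scale R (p + 1).
    koszul_cup_bracket scale R 1 p M (fundamental_cocycle scale R) f w =
    \<ominus>\<^bsub>M\<^esub> koszul_differential scale R p M f w"
proof
  fix w
  assume w: "w \<in> koszul_space scale R (p + 1)"
  define T where "T = tensor_algebra scale"
  define A where "A = quadratic_algebra scale R"
  define \<pi> where "\<pi> = quadratic_projection scale R"
  define W where "W = koszul_space scale R p"
  define V where "V = tensor_power scale 1"
  define k where "k = (- 1 :: int) ^ p"
  interpret VS: vector_space scale by fact
  \<comment> \<open>A basis of \<open>V\<close> is obtained by extending the empty independent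
    set.\<close>
  interpret vector_space_basis scale "VS.extend_basis {}"
    by unfold_locales
      (simp_all add: VS.independent_extend_basis VS.span_extend_basis VS.independent_empty)
  interpret M: bimodule A M
    using assms(3) by (simp add: quadratic_bimodule_def A_def)
  let ?reg = "regular_bimodule A"
  let ?L = "tensor_over A ?reg M" and ?R = "tensor_over A M ?reg"
  have sym: "lact M (quadratic_scalar scale R c) x = ract M x (quadratic_scalar scale R c)"
    if "x \<in> carrier M" for c x
    using assms(3) that by (auto simp: quadratic_bimodule_def)
  \<comment> \<open>The second equation identifies \<open>V\<close> with the Koszul space in degree
    1, as it occurs in the cup products; \<open>Suc 0\<close> is the form to which simplification
    brings the degree.\<close>
  have V: "V = tensor_coset scale ` basis_words 1" "V = koszul_space scale R (Suc 0)"
    by (simp_all add: V_def tensor_power_eq koszul_space_def)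
  have W: "W = tensor_coset scale ` koszul_nf R p"
    unfolding W_def by (rule koszul_space_eq[OF assms(2)])
  have V_carrier: "x \<in> carrier T" if "x \<in> V" for x
    using that tensor_power_carrier by (auto simp: V_def T_def)
  have \<pi>_closed: "\<pi> x \<in> carrier A" if "x \<in> V" for x
    using ring_hom_closed[OF quadratic_projection_ring_hom[OF assms(2)]] V_carrier[OF that]
    by (simp add: \<pi>_def A_def T_def)
  have \<pi>_add: "\<pi> (x \<oplus>\<^bsub>T\<^esub> y) = \<pi> x \<oplus>\<^bsub>A\<^esub> \<pi> y" if "x \<in> V" "y \<in> V" for x y
    using ring_hom_add[OF quadratic_projection_ring_hom[OF assms(2)]] that V_carrier
    by (simp add: \<pi>_def A_def T_def)
  have \<pi>_smult: "\<pi> (c \<odot>\<^bsub>T\<^esub> x) = quadratic_scalar scale R c \<otimes>\<^bsub>A\<^esub> \<pi> x"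
    "\<pi> (c \<odot>\<^bsub>T\<^esub> x) = \<pi> x \<otimes>\<^bsub>A\<^esub> quadratic_scalar scale R c" if "x \<in> V" for c x
    using quadratic_projection_smult[OF assms(2)] V_carrier[OF that]
    by (simp_all add: \<pi>_def A_def T_def)
  have scalar_A: "quadratic_scalar scale R c \<in> carrier A" for c
    unfolding A_def by (rule quadratic_scalar_closed[OF assms(2)])
  have f: "f u \<in> carrier M" "u' \<in> W \<Longrightarrow> f (u \<oplus>\<^bsub>T\<^esub> u') = f u \<oplus>\<^bsub>M\<^esub> f u'"
    "f (c \<odot>\<^bsub>T\<^esub> u) = lact M (quadratic_scalar scale R c) (f u)" if "u \<in> W" for u u' c
    using assms(4) that by (auto simp: koszul_cochain_def W_def T_def)

  define right where "right u x = ract M (f u) (\<pi> x)" for u x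
  define left where "left x u = lact M (\<pi> x) (f u)" for x u
  obtain m a b where ab: "w = finsum T (\<lambda>i. a i \<otimes>\<^bsub>T\<^esub> b i) {..<m}"
      "\<And>i. i < (m::nat) \<Longrightarrow> a i \<in> W" "\<And>i. i < m \<Longrightarrow> b i \<in> V"
    using subsetD[OF koszul_space_Suc_subset(1)[OF assms(2)], of w p] w
    unfolding tensor_span_def T_def W_def V_def by auto
  obtain m' a' b' where ab': "w = finsum T (\<lambda>i. a' i \<otimes>\<^bsub>T\<^esub> b' i) {..<m'}"
      "\<And>i. i < (m'::nat) \<Longrightarrow> a' i \<in> V" "\<And>i. i < m' \<Longrightarrow> b' i \<in> W"
    using subsetD[OF koszul_space_Suc_subset(2)[OF assms(2)], of w p] w
    unfolding tensor_span_def T_def W_def V_def by auto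
  define n where "n = finsum M (\<lambda>i. right (a i) (b i)) {..<m}"
  define n' where "n' = finsum M (\<lambda>i. left (a' i) (b' i)) {..<m'}"
  have right_closed: "right u x \<in> carrier M" if "u \<in> W" "x \<in> V" for u x
    using that by (simp add: right_def M.ract_closed f \<pi>_closed)
  have left_closed: "left x u \<in> carrier M" if "u \<in> W" "x \<in> V" for u x
    using that by (simp add: left_def M.lact_closed f \<pi>_closed)
  have n: "n \<in> carrier M" "n' \<in> carrier M"
    using ab ab' by (auto simp: n_def n'_def intro!: M.finsum_closed right_closed left_closed)

  \<comment> \<open>Kept general in \<open>N\<close> and \<open>\<phi>\<close>: the identity of
    \<open>M\<close> gives a term of the differential, and \<open>x \<mapsto> x \<otimes> 1\<close>
    gives a cup product.\<close>
  have lift_right: "tensor_lift T W V N \<beta> w = \<phi> n"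
    if "Group.comm_monoid N" "\<phi> \<in> hom (add_monoid M) N" "\<phi> \<zero>\<^bsub>M\<^esub> = \<one>\<^bsub>N\<^esub>"
      "\<And>u x. u \<in> W \<Longrightarrow> x \<in> V \<Longrightarrow> \<beta> u x = \<phi> (right u x)"
    for N :: "('n, 'z) monoid_scheme" and \<phi> \<beta>
    unfolding n_def T_def
  proof (rule tensor_lift_eq[where S = "koszul_nf R p" and S' = "basis_words 1" and U = W and U' = V
        and \<beta> = right, OF M.M.abelian_group_axioms scalar_closed_koszul_nf koszul_nf_basis_words
        scalar_closed_basis_words order_refl W V(1) _ _ _ _ that ab(2,3,1)[unfolded T_def]])
    fix u u' x x' c
    assume u: "u \<in> W" and u': "u' \<in> W" and x: "x \<in> V" and x': "x' \<in> V"
    show "right u x \<in> carrier M" using u x by (rule right_closed)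
    show "right (u \<oplus>\<^bsub>tensor_algebra scale\<^esub> u') x = right u x \<oplus>\<^bsub>M\<^esub> right u' x"
      using u u' x by (simp add: right_def f \<pi>_closed M.ract_l_distr flip: T_def)
    show "right u (x \<oplus>\<^bsub>tensor_algebra scale\<^esub> x') = right u x \<oplus>\<^bsub>M\<^esub> right u x'"
      using u x x' by (simp add: right_def f \<pi>_closed \<pi>_add M.ract_r_distr flip: T_def)
    \<comment> \<open>Symmetry of the bimodule enters here: the scalar leaves \<open>f\<close> on
      the left, is turned into a right action, and then joins \<open>x\<close>.\<close>
    show "right (c \<odot>\<^bsub>tensor_algebra scale\<^esub> u) x = right u (c \<odot>\<^bsub>tensor_algebra scale\<^esub> x)"
      using u x by (simp add: right_def f \<pi>_closed \<pi>_smult(1) M.ract_assoc scalar_A sym flip: T_def)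
  qed
  have lift_left: "tensor_lift T V W N \<beta> w = \<phi> n'"
    if "Group.comm_monoid N" "\<phi> \<in> hom (add_monoid M) N" "\<phi> \<zero>\<^bsub>M\<^esub> = \<one>\<^bsub>N\<^esub>"
      "\<And>x u. x \<in> V \<Longrightarrow> u \<in> W \<Longrightarrow> \<beta> x u = \<phi> (left x u)"
    for N :: "('n, 'z) monoid_scheme" and \<phi> \<beta>
    unfolding n'_def T_def
  proof (rule tensor_lift_eq[where S = "basis_words 1" and S' = "koszul_nf R p" and U = V and U' = W
        and \<beta> = left, OF M.M.abelian_group_axioms scalar_closed_basis_words order_refl
        scalar_closed_koszul_nf koszul_nf_basis_words V(1) W _ _ _ _ that ab'(2,3,1)[unfolded T_def]])
    fix u u' x x' c
    assume u: "u \<in> W" and u': "u' \<in> W" and x: "x \<in> V" and x': "x' \<in> V"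
    show "left x u \<in> carrier M" using u x by (rule left_closed)
    show "left x (u \<oplus>\<^bsub>tensor_algebra scale\<^esub> u') = left x u \<oplus>\<^bsub>M\<^esub> left x u'"
      using u u' x by (simp add: left_def f \<pi>_closed M.lact_r_distr flip: T_def)
    show "left (x \<oplus>\<^bsub>tensor_algebra scale\<^esub> x') u = left x u \<oplus>\<^bsub>M\<^esub> left x' u"
      using u x x' by (simp add: left_def f \<pi>_closed \<pi>_add M.lact_l_distr flip: T_def)
    show "left (c \<odot>\<^bsub>tensor_algebra scale\<^esub> x) u = left x (c \<odot>\<^bsub>tensor_algebra scale\<^esub> u)"
      using u x by (simp add: left_def f \<pi>_closed \<pi>_smult(2) M.lact_assoc scalar_A flip: T_def)
  qed

  have differential: "koszul_differential scale R p M f w = n \<ominus>\<^bsub>M\<^esub> add_pow M k n'"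
  proof -
    have id: "(\<lambda>x. x) \<in> hom (add_monoid M) (add_monoid M)" by (simp add: hom_def)
    have "tensor_lift T W V (add_monoid M) (\<lambda>u x. ract M (f u) (\<pi> x)) w = n"
      by (rule lift_right[OF M.M.a_comm_monoid id]) (simp_all add: right_def)
    moreover have "tensor_lift T V W (add_monoid M) (\<lambda>x u. lact M (\<pi> x) (f u)) w = n'"
      by (rule lift_left[OF M.M.a_comm_monoid id]) (simp_all add: left_def)
    ultimately show ?thesis
      unfolding koszul_differential_def T_def W_def V_def \<pi>_def k_def by simp
  qed

  let ?l = "\<lambda>x. pure_tensor A ?reg M \<one>\<^bsub>A\<^esub> x" and ?r = "\<lambda>x. pure_tensor A M ?reg x \<one>\<^bsub>A\<^esub>"
  have L: "comm_group ?L" and R: "comm_group ?R"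
    by (rule bimodule_pair.comm_group_tensor_over, rule M.bimodule_pair_left M.bimodule_pair_right)+
  have l_hom: "?l \<in> hom (add_monoid M) ?L" and r_hom: "?r \<in> hom (add_monoid M) ?R"
    by (rule M.left_pure_tensor_hom M.right_pure_tensor_hom)+
  have L': "group ?L" "Group.comm_monoid ?L" and R': "group ?R" "Group.comm_monoid ?R"
    using L R by (auto simp: comm_group_def)
  have one: "?l \<zero>\<^bsub>M\<^esub> = \<one>\<^bsub>?L\<^esub>" "?r \<zero>\<^bsub>M\<^esub> = \<one>\<^bsub>?R\<^esub>"
    using hom_one[OF l_hom M.M.a_group L'(1)] hom_one[OF r_hom M.M.a_group R'(1)] by simp_all
  \<comment> \<open>The sign is a power in the tensor product. Moving it inside the homomorphism
    \<open>?l\<close> leaves a single tensor \<open>1 \<otimes> x\<close>, to which the unitor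
    applies.\<close>
  have "koszul_cup scale R 1 p ?reg M (fundamental_cocycle scale R) f w = ?l (add_pow M k n')"
  proof -
    have "tensor_lift T V W ?L (\<lambda>x u. pure_tensor A ?reg M (\<pi> x) (f u)) w = ?l n'"
      by (rule lift_left[OF L'(2) l_hom one(1)])
        (simp add: left_def M.pure_tensor_left_one \<pi>_closed f)
    then show ?thesis
      using hom_int_pow[OF l_hom _ M.M.a_group L'(1), of n' k] n
      by (simp add: koszul_cup_def fundamental_cocycle_def add_pow_def k_def
          flip: V(2) A_def T_def W_def \<pi>_def)
  qed
  moreover have "koszul_cup scale R p 1 M ?reg f (fundamental_cocycle scale R) w = ?r (add_pow M k n)"
  proof -
    have "tensor_lift T W V ?R (\<lambda>u x. pure_tensor A M ?reg (f u) (\<pi> x)) w = ?r n"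
      by (rule lift_right[OF R'(2) r_hom one(2)])
        (simp add: right_def M.pure_tensor_right_one \<pi>_closed f)
    then show ?thesis
      using hom_int_pow[OF r_hom _ M.M.a_group R'(1), of n k] n
      by (simp add: koszul_cup_def fundamental_cocycle_def add_pow_def k_def
          flip: V(2) A_def T_def W_def \<pi>_def)
  qed
  \<comment> \<open>The exponents \<open>1 * p\<close> and \<open>p * 1\<close> both equal
    \<open>p\<close>. The term with \<open>n\<close> carries the sign twice, once from the cup
    product and once from the bracket.\<close>
  ultimately have "koszul_cup_bracket scale R 1 p M (fundamental_cocycle scale R) f w =
      add_pow M k n' \<ominus>\<^bsub>M\<^esub> add_pow M k (add_pow M k n)"
    using n
    by (simp add: koszul_cup_bracket_def Let_def M.left_unitor_pure_tensor M.right_unitor_pure_tensor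
        k_def flip: A_def)
  also have "\<dots> = \<ominus>\<^bsub>M\<^esub> (n \<ominus>\<^bsub>M\<^esub> add_pow M k n')"
    unfolding k_def by (rule M.M.sign_bracket) (use n in auto)
  finally show "koszul_cup_bracket scale R 1 p M (fundamental_cocycle scale R) f w =
      \<ominus>\<^bsub>M\<^esub> koszul_differential scale R p M f w"
    by (simp only: differential)
qed

end
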